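(* There exists a positive absolute constant $c$ such that the following holds. Let $p$ be a prime and let $A,B\subseteq\mathbb{Z}/p\mathbb{Z}$ satisfy $1<|A|<p/2$ and $0<|B|<\min\{\sqrt{p/8},\,c|A|/\ln|A|\}$. Then for every mapping $\tau\colon B\to A$ we have $|A\stackrel{\tau}{+}B|\ge |A|+|B|-3$.
   Context: $\mathbb{Z}/p\mathbb{Z}$ is the cyclic group of prime order $p$; $\ln$ is the natural logarithm. For a mapping $\tau\colon B\to A$, the restricted sumset is $A\stackrel{\tau}{+}B:=\{a+b: a\in A,\ b\in B,\ a\ne\tau(b)\}$. *)

theory Defs
  imports Complex_Main "HOL-Number_Theory.Residues" "HOL-Library.FuncSet"
begin

definition restricted_sumset ::
  "('a, 'm) ring_scheme \<Rightarrow> ('a \<Rightarrow> 'a) \<Rightarrow> 'a set \<Rightarrow> 'a set \<Rightarrow> 'a set" where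
  "restricted_sumset R \<tau> A B = {a \<oplus>\<^bsub>R\<^esub> b | a b. a \<in> A \<and> b \<in> B \<and> a \<noteq> \<tau> b}"

end

theory Submission imports Defs
begin

text \<open>
  Let \<open>n = |A|\<close>, \<open>k = |B| - 2\<close>, and let \<open>\<delta> x\<close> be the number of \<open>a \<in> A\<close> with \<open>a + x \<notin> A\<close>.
  If the restricted sumset had at most \<open>n + |B| - 4\<close> elements, then \<open>\<delta> \<le> k\<close> on \<open>B - B\<close>.
  The function \<open>\<delta>\<close> is even and subadditive, the sum of \<open>n - \<delta>\<close> over the group is \<open>n\<^sup>2\<close>, and
  \<open>\<delta>\<close> is a combination of the functions \<open>1 - cos (2\<pi>rx/p)\<close> with nonnegative weights. As \<open>k\<close> is
  tiny compared with \<open>n\<close>, some nontrivial frequency makes these small on average over \<open>B - B\<close>, so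
  that after a dilation most of \<open>B\<close> lies in a short arc. Growth of iterated sums and the
  identity for the sum of \<open>n - \<delta>\<close> then place a dilate of all of \<open>B\<close> in an interval of length
  \<open>L \<le> 1.01 k\<close>. Two consecutive differences give \<open>\<delta> 1 \<le> 2k\<close>, so \<open>A\<close> consists of at most \<open>2k\<close>
  arcs and, since \<open>p > 8 |B|\<^sup>2\<close>, has a gap of length \<open>L\<close>; cutting there turns \<open>A\<close> into a set of integers.

  In the integers, \<open>\<delta> L \<le> k < L\<close> forces \<open>A\<close> to miss a residue class modulo \<open>L\<close>, so every window
  of length \<open>L\<close> contains a hole. The bounds on \<open>\<delta> d\<close> for the \<open>2i\<close> largest differences \<open>d\<close> allow only
  \<open>O(i)\<close> holes preceded by at most \<open>i\<close> holes within distance \<open>L\<close>. Hence the sum over holes of the reciprocals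
  of these counts is \<open>O(ln k)\<close>, while each dense window contributes a constant to it, so there are
  \<open>O(ln k)\<close> dense windows and \<open>n = O(k ln k)\<close>, contrary to the hypothesis.
\<close>

section \<open>Sets of integers with few exits\<close>

definition exits :: "int set \<Rightarrow> int \<Rightarrow> nat" where
  "exits A d = card {a \<in> A. a + d \<notin> A}"

lemma card_filter_add_not:
  assumes "finite A"
  shows "card {x \<in> A. P x} + card {x \<in> A. \<not> P x} = card A"
proof -
  have "{x \<in> A. P x} \<union> {x \<in> A. \<not> P x} = A" by auto
  then show ?thesis using assms by (metis (no_types, lifting) card_Un_disjoint disjoint_iff finite_Un mem_Collect_eq)
qed

text \<open>Elements of \<open>A\<close> above \<open>t - d\<close> that stay in \<open>A\<close>
  under the shift land injectively above \<open>t\<close>, so at least as many of them exit as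
  \<open>A\<close> has elements in \<open>{t-d<..t}\<close>. The exits from elements at most
  \<open>t - d\<close> are exactly the pairs counted by \<open>h\<close>.\<close>

lemma exits_ge:
  assumes "finite A" "d > 0"
  shows "card (A \<inter> {t-d<..t}) + card {h. h \<le> t \<and> h \<notin> A \<and> h - d \<in> A} \<le> exits A d"
proof -
  let ?U = "{a \<in> A. a > t - d \<and> a + d \<notin> A}" and ?V = "{a \<in> A. a > t - d \<and> a + d \<in> A}"
  let ?W = "{a \<in> A. a \<le> t - d \<and> a + d \<notin> A}"
  have "card {h. h \<le> t \<and> h \<notin> A \<and> h - d \<in> A} = card ?W"
    by (rule bij_betw_same_card[of "\<lambda>h. h - d"], rule bij_betw_byWitness[where f' = "\<lambda>a. a + d"]) auto
  moreover have "{a \<in> A. a + d \<notin> A} = ?U \<union> ?W" by auto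
  then have "exits A d = card ?U + card ?W"
    unfolding exits_def using assms by (simp add: card_Un_disjoint disjoint_iff)
  moreover have "card ?V \<le> card {a \<in> A. a > t}"
    using assms by (intro card_inj_on_le[of "\<lambda>a. a + d"]) auto
  moreover have "card ?U + card ?V = card {a \<in> A. a > t - d}"
    using card_filter_add_not[of "{a \<in> A. a > t - d}" "\<lambda>a. a + d \<notin> A"] assms(1)
    by (simp add: conj_assoc)
  moreover have "card {a \<in> A. a > t - d} = card (A \<inter> {t-d<..t}) + card {a \<in> A. a > t}"
  proof -
    have "A \<inter> {t-d<..t} = {a \<in> {a \<in> A. a > t - d}. a \<le> t}"
      and "{a \<in> A. a > t} = {a \<in> {a \<in> A. a > t - d}. \<not> a \<le> t}" using assms(2) by auto
    then show ?thesis using card_filter_add_not[of "{a \<in> A. a > t - d}" "\<lambda>a. a \<le> t"] assms(1) by simp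
  qed
  ultimately show ?thesis by linarith
qed

text \<open>The pairs in \<open>A\<close> at distance \<open>d\<close> can be counted from either
  end, hence so can the exits.\<close>

lemma exits_reflect:
  assumes "finite A"
  shows "exits (uminus ` A) d = exits A d"
proof -
  have "exits (uminus ` A) d = card {a \<in> A. a - d \<notin> A}"
    unfolding exits_def
    by (rule bij_betw_same_card[of uminus], rule bij_betw_byWitness[where f' = uminus])
      (auto simp: image_iff algebra_simps)
  moreover have "card {a \<in> A. a - d \<notin> A} + card {a \<in> A. a - d \<in> A} = card A"
    using card_filter_add_not[OF assms, of "\<lambda>a. a - d \<notin> A"] by simp
  moreover have "card {a \<in> A. a + d \<notin> A} + card {a \<in> A. a + d \<in> A} = card A"
    using card_filter_add_not[OF assms, of "\<lambda>a. a + d \<notin> A"] by simp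
  moreover have "card {a \<in> A. a + d \<in> A} = card {a \<in> A. a - d \<in> A}"
    by (rule bij_betw_same_card[of "\<lambda>a. a + d"], rule bij_betw_byWitness[where f' = "\<lambda>a. a - d"]) auto
  ultimately show ?thesis unfolding exits_def by linarith
qed

section \<open>Auxiliary counting and harmonic sums\<close>

lemma ex_large_elements:
  fixes D :: "int set"
  assumes "finite D" "D \<subseteq> {1..}" "Y \<le> card D"
  shows "\<exists>T \<subseteq> D. card T = Y \<and> (\<forall>d\<in>T. d \<ge> int (card D) - int Y + 1)"
  using assms(3)
proof (induction Y)
  case 0
  then show ?case by (intro exI[of _ "{}"]) auto
next
  case (Suc Y)
  then obtain T where T: "T \<subseteq> D" "card T = Y" "\<forall>d\<in>T. d \<ge> int (card D) - int Y + 1" by auto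
  have fT: "finite T" using T assms finite_subset by blast
  have cd: "card (D - T) = card D - Y" using T fT by (simp add: card_Diff_subset)
  with Suc.prems have ne: "D - T \<noteq> {}" by (metis card.empty not_less_eq_eq zero_less_diff less_irrefl Suc_le_eq)
  \<comment> \<open>\<open>D - T\<close> has \<open>card D - Y\<close> positive elements, so its
    maximum is at least that number.\<close>
  define x where "x = Max (D - T)"
  have x: "x \<in> D - T" unfolding x_def using assms(1) ne by (intro Max_in) auto
  have "D - T \<subseteq> {1..x}" unfolding x_def using assms by (auto intro!: Max_ge)
  then have "card (D - T) \<le> card {1..x}" by (intro card_mono) auto
  then have "int (card D) - int Y \<le> x" using cd Suc.prems by auto
  then show ?case using T x fT by (intro exI[of _ "insert x T"]) auto
qed

lemma bij_betw_rank:
  fixes H :: "'a::linorder set"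
  assumes "finite H"
  shows "bij_betw (\<lambda>h. card {x \<in> H. x < h}) H {..<card H}"
proof -
  have lt: "card {x \<in> H. x < h} < card {x \<in> H. x < h'}" if "h \<in> H" "h < h'" for h h'
    using that assms by (intro psubset_card_mono) auto
  have "inj_on (\<lambda>h. card {x \<in> H. x < h}) H"
  proof (rule inj_onI)
    fix x y assume "x \<in> H" "y \<in> H" "card {z \<in> H. z < x} = card {z \<in> H. z < y}"
    then show "x = y" using lt[of x y] lt[of y x] by (cases x y rule: linorder_cases) auto
  qed
  moreover have "(\<lambda>h. card {x \<in> H. x < h}) ` H \<subseteq> {..<card H}"
    using assms by (auto intro!: psubset_card_mono)
  ultimately show ?thesis
    unfolding bij_betw_def by (simp add: card_image card_subset_eq)
qed

lemma sum_inverse_ge_ln: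
  assumes "c \<ge> (1::nat)"
  shows "(\<Sum>r<m. 1 / real (c + r)) \<ge> ln (real (c + m) / real c)"
proof (induction m)
  case 0
  then show ?case using assms by simp
next
  case (Suc m)
  have "real (c + Suc m) / real c = (real (c + m) / real c) * (1 + 1 / real (c + m))"
    using assms by (simp add: divide_simps)
  then have "ln (real (c + Suc m) / real c) = ln (real (c + m) / real c) + ln (1 + 1 / real (c + m))"
    using assms by (simp only:) (intro ln_mult_pos; simp add: add_pos_nonneg)
  also have "ln (1 + 1 / real (c + m)) \<le> 1 / real (c + m)"
    by (rule ln_add_one_self_le_self) auto
  finally show ?case using Suc.IH by simp
qed

lemma sum_inverse_Suc_le_ln:
  "F \<ge> 1 \<Longrightarrow> (\<Sum>i=1..<F. 1 / real (Suc i)) \<le> ln (real F)"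
proof (induction F rule: dec_induct)
  case base
  then show ?case by simp
next
  case (step F)
  have "ln (real F) - ln (real (Suc F)) \<le> (real F - real (Suc F)) / real (Suc F)"
    using step(1) by (intro ln_diff_le) auto
  then have "1 / real (Suc F) \<le> ln (real (Suc F)) - ln (real F)" by simp
  then show ?case using step by simp
qed

text \<open>Partial summation: \<open>1 / \<sigma> h\<close> is \<open>1 / F\<close> plus a
  telescoping sum of \<open>1 / (i * (i + 1))\<close>, after which the linear counts turn the
  \<open>i\<close>-th term into at most \<open>6 / (i + 1)\<close>.\<close>

lemma sum_inverse_le_of_linear_count:
  fixes \<sigma> :: "'a \<Rightarrow> nat"
  assumes fin: "finite Q" and rng: "\<And>h. h \<in> Q \<Longrightarrow> 1 \<le> \<sigma> h \<and> \<sigma> h \<le> F" and F: "F \<ge> 1"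
    and cnt: "\<And>i. i \<le> F \<Longrightarrow> card {h \<in> Q. \<sigma> h \<le> i} \<le> 6 * i"
  shows "(\<Sum>h\<in>Q. 1 / real (\<sigma> h)) \<le> 6 + 6 * ln (real F)"
proof -
  have tele: "1 / real s = 1 / real F + (\<Sum>i=s..<F. 1 / (real i * real (Suc i)))" if "1 \<le> s" "s \<le> F" for s
    using that(2,1)
  proof (induction rule: inc_induct)
    case base
    then show ?case by simp
  next
    case (step n)
    have "1 / real n = 1 / real (Suc n) + 1 / (real n * real (Suc n))"
      using step by (simp add: divide_simps)
    then show ?case using step by (simp add: sum.atLeast_Suc_lessThan)
  qed
  have "(\<Sum>h\<in>Q. 1 / real (\<sigma> h)) =
      (\<Sum>h\<in>Q. 1 / real F + (\<Sum>i=1..<F. if \<sigma> h \<le> i then 1 / (real i * real (Suc i)) else 0))"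
  proof (rule sum.cong[OF refl])
    fix h assume h: "h \<in> Q"
    have "(\<Sum>i=1..<F. if \<sigma> h \<le> i then 1 / (real i * real (Suc i)) else 0)
        = (\<Sum>i=\<sigma> h..<F. 1 / (real i * real (Suc i)))"
      using rng[OF h] by (subst sum.inter_filter[symmetric]) (auto intro!: sum.cong)
    moreover have "1 / real (\<sigma> h) = 1 / real F + (\<Sum>i=\<sigma> h..<F. 1 / (real i * real (Suc i)))"
      using rng[OF h] by (intro tele) auto
    ultimately show "1 / real (\<sigma> h) = 1 / real F + (\<Sum>i=1..<F. if \<sigma> h \<le> i then 1 / (real i * real (Suc i)) else 0)"
      by (simp only:)
  qed
  also have "\<dots> = real (card Q) / real F
      + (\<Sum>i=1..<F. \<Sum>h\<in>Q. if \<sigma> h \<le> i then 1 / (real i * real (Suc i)) else 0)"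
    unfolding sum.distrib by (rule arg_cong2[of _ _ _ _ plus], simp, rule sum.swap)
  also have "\<dots> = real (card {h\<in>Q. \<sigma> h \<le> F}) / real F
      + (\<Sum>i=1..<F. real (card {h\<in>Q. \<sigma> h \<le> i}) / (real i * real (Suc i)))"
  proof -
    have "{h\<in>Q. \<sigma> h \<le> F} = Q" using rng by auto
    moreover have "(\<Sum>h\<in>Q. if \<sigma> h \<le> i then c else 0) = real (card {h\<in>Q. \<sigma> h \<le> i}) * c" for i c
      using fin by (subst sum.inter_filter[symmetric]) auto
    ultimately show ?thesis by simp
  qed
  also have "\<dots> \<le> 6 + (\<Sum>i=1..<F. 6 * (1 / real (Suc i)))"
  proof (intro add_mono sum_mono)
    show "real (card {h\<in>Q. \<sigma> h \<le> F}) / real F \<le> 6"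
    proof -
      have "real (card {h\<in>Q. \<sigma> h \<le> F}) \<le> real (6 * F)" using cnt[of F] by (intro of_nat_mono) auto
      then show ?thesis using F by (simp add: pos_divide_le_eq)
    qed
    fix i assume i: "i \<in> {1..<F}"
    have "real (card {h\<in>Q. \<sigma> h \<le> i}) \<le> real (6 * i)" using cnt[of i] i by (intro of_nat_mono) auto
    then have "real (card {h\<in>Q. \<sigma> h \<le> i}) / (real i * real (Suc i)) \<le> real (6 * i) / (real i * real (Suc i))"
      by (intro divide_right_mono) auto
    then show "real (card {h\<in>Q. \<sigma> h \<le> i}) / (real i * real (Suc i)) \<le> 6 * (1 / real (Suc i))"
      using i by simp
  qed
  also have "\<dots> \<le> 6 + 6 * ln (real F)"
    unfolding sum_distrib_left[symmetric] using sum_inverse_Suc_le_ln[OF F] by simp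
  finally show ?thesis .
qed

text \<open>Here \<open>L\<close> is the largest difference, and \<open>t\<close> ends a window of
  length \<open>L\<close> with the fewest holes (nonmembers of \<open>A\<close>). Only the side to
  the left of \<open>t\<close> is studied; the other side follows by reflection.\<close>

locale sparse_exits =
  fixes A D :: "int set" and L t :: int and k :: nat
  assumes finA: "finite A" and D: "D \<subseteq> {1..L}" and L: "L \<in> D" and cardD: "k + 1 \<le> card D"
    and ex: "\<And>d. d \<in> D \<Longrightarrow> exits A d \<le> k"
    and tmin: "\<And>x. card ({t-L<..t} - A) \<le> card ({x-L<..x} - A)"
begin

abbreviation \<sigma> :: "int \<Rightarrow> nat" where "\<sigma> h \<equiv> card ({h-L..<h} - A)"
abbreviation W :: "nat \<Rightarrow> int set" where "W j \<equiv> {t - (int j + 1) * L<..t - int j * L}"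

lemma finD: "finite D" using D finite_subset by blast
lemma Lpos: "L \<ge> 1" using D L by auto
lemma cardD_le: "int (card D) \<le> L"
  using card_mono[OF _ D] Lpos by auto

text \<open>A window inside \<open>A\<close> would give \<open>L\<close> exits at shift
  \<open>L\<close> by \<open>exits_ge\<close>, whereas \<open>L \<ge> card D > k\<close>.\<close>

lemma window_meets_complement: "card ({x-L<..x} - A) \<ge> 1"
proof (rule ccontr)
  assume "\<not> ?thesis"
  then have "card ({x-L<..x} - A) = 0" by linarith
  then have "{x-L<..x} \<subseteq> A" by simp
  then have "A \<inter> {x-L<..x} = {x-L<..x}" by auto
  then have "nat L \<le> exits A L" using exits_ge[OF finA, of L x] Lpos by simp
  then have "nat L \<le> k" using ex[OF L] by linarith
  then show False using cardD cardD_le by linarith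
qed

lemma \<sigma>_ge: "card ({t-L<..t} - A) \<le> \<sigma> h"
proof -
  have "{h-1-L<..h-1} = {h-L..<h}" by auto
  then show ?thesis using tmin[of "h-1"] by simp
qed

text \<open>A stretch of length \<open>L\<close> with at most \<open>i < L\<close> holes contains an
  element of \<open>A\<close>, so \<open>h\<close> lies within \<open>L\<close> of the finite set
  \<open>A\<close>.\<close>

lemma finite_\<sigma>: assumes "int i < L" shows "finite {h. h \<le> t \<and> h \<notin> A \<and> \<sigma> h \<le> i}"
proof (rule finite_subset)
  show "{h. h \<le> t \<and> h \<notin> A \<and> \<sigma> h \<le> i} \<subseteq> (\<Union>a\<in>A. {a..a+L})"
  proof
    fix h assume h: "h \<in> {h. h \<le> t \<and> h \<notin> A \<and> \<sigma> h \<le> i}"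
    have "{h-L..<h} \<inter> A \<noteq> {}"
    proof
      assume "{h-L..<h} \<inter> A = {}"
      then have "{h-L..<h} - A = {h-L..<h}" by auto
      with h have "nat L \<le> i" by simp
      then show False using assms by linarith
    qed
    then show "h \<in> (\<Union>a\<in>A. {a..a+L})" by force
  qed
  show "finite (\<Union>a\<in>A. {a..a+L})" using finA by auto
qed

text \<open>Summing the bound of \<open>exits_ge\<close> over the \<open>2i\<close> largest elements of \<open>D\<close> weighs each
  nonmember \<open>h \<le> t\<close> having few nonmembers shortly to its left by at least \<open>i\<close>.\<close>
lemma card_\<sigma>_le:
  assumes "2 * i \<le> card D"
  shows "card {h. h \<le> t \<and> h \<notin> A \<and> \<sigma> h \<le> i} \<le> 6 * i"
proof -
  define s where "s = card ({t-L<..t} - A)"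
  define Q where "Q = {h. h \<le> t \<and> h \<notin> A \<and> \<sigma> h \<le> i}"
  have s1: "s \<ge> 1" unfolding s_def by (rule window_meets_complement)
  show ?thesis
  proof (cases "i < s")
    case True
    then have "\<not> \<sigma> h \<le> i" for h using \<sigma>_ge[of h] unfolding s_def by linarith
    then have "{h. h \<le> t \<and> h \<notin> A \<and> \<sigma> h \<le> i} = {}" by blast
    then show ?thesis by (simp only: card.empty)
  next
    case False
    have finQ: "finite Q" unfolding Q_def using finite_\<sigma> assms cardD_le s1 False by auto
    obtain T where T: "T \<subseteq> D" "card T = 2 * i" "\<forall>d\<in>T. d \<ge> int (card D) - int (2 * i) + 1"
      using ex_large_elements[OF finD _ assms] D by force
    have finT: "finite T" using T finD finite_subset by blast
    \<comment> \<open>The window \<open>{t-d<..t}\<close> has at least \<open>d - s\<close> members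
      of \<open>A\<close>, and \<open>d\<close> exceeds \<open>card D - 2 * i\<close>, hence
      \<open>k - 2 * i\<close>. By \<open>exits_ge\<close> at most \<open>2 * i + s\<close> of the
      \<open>k\<close> exits remain for the pairs counted here.\<close>
    have c1: "card {h\<in>Q. h - d \<in> A} \<le> 2 * i + s" if d: "d \<in> T" for d
    proof -
      have dD: "d \<in> D" "d \<ge> 1" "d \<le> L" using d T D by auto
      have "card {h\<in>Q. h - d \<in> A} \<le> card {h. h \<le> t \<and> h \<notin> A \<and> h - d \<in> A}"
      proof (rule card_mono)
        have "{h. h \<le> t \<and> h \<notin> A \<and> h - d \<in> A} \<subseteq> (\<lambda>a. a + d) ` A" by (auto intro: rev_image_eqI)
        then show "finite {h. h \<le> t \<and> h \<notin> A \<and> h - d \<in> A}" using finA finite_surj by blast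
      qed (auto simp: Q_def)
      moreover have "card (A \<inter> {t-d<..t}) + card {h. h \<le> t \<and> h \<notin> A \<and> h - d \<in> A} \<le> k"
        using exits_ge[OF finA, of d t] ex[OF dD(1)] dD by linarith
      moreover have "card ({t-d<..t} - A) \<le> s" unfolding s_def using dD by (intro card_mono) auto
      moreover have "card (A \<inter> {t-d<..t}) + card ({t-d<..t} - A) = nat d"
        using dD card_filter_add_not[of "{t-d<..t}" "\<lambda>a. a \<in> A"]
        by (simp add: Int_def set_diff_eq conj_commute)
      moreover have "d \<ge> int (card D) - int (2 * i) + 1" using T d by blast
      ultimately show ?thesis using cardD dD by linarith
    qed
    \<comment> \<open>Going back from \<open>h\<close> by the \<open>2 * i\<close> differences in
      \<open>T\<close> meets at most \<open>\<sigma> h \<le> i\<close> holes.\<close>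
    have c2: "i \<le> card {d\<in>T. h - d \<in> A}" if h: "h \<in> Q" for h
    proof -
      have "card {d\<in>T. h - d \<notin> A} \<le> \<sigma> h"
        using T(1) D by (intro card_inj_on_le[of "\<lambda>d. h - d"]) (auto simp: inj_on_def)
      then have "card {d\<in>T. h - d \<notin> A} \<le> i" using h unfolding Q_def by simp
      moreover have "card {d\<in>T. h - d \<notin> A} + card {d\<in>T. h - d \<in> A} = card T"
        using card_filter_add_not[OF finT, of "\<lambda>d. h - d \<notin> A"] by simp
      ultimately show ?thesis using T by linarith
    qed
    have "card Q * i \<le> (\<Sum>h\<in>Q. card {d\<in>T. h - d \<in> A})"
      using sum_mono[of Q "\<lambda>_. i" "\<lambda>h. card {d\<in>T. h - d \<in> A}"] c2 by simp
    also have "\<dots> = (\<Sum>d\<in>T. card {h\<in>Q. h - d \<in> A})"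
      using sum_multicount_gen[of Q T "\<lambda>h d. h - d \<in> A"] finQ finT
      by (simp add: sum_multicount_gen)
    also have "\<dots> \<le> 2 * i * (2 * i + s)"
      using sum_bounded_above[of T "\<lambda>d. card {h\<in>Q. h - d \<in> A}" "2 * i + s"] c1 T(2) by simp
    finally have "i * card Q \<le> i * (2 * (2 * i + s))" by (simp add: algebra_simps)
    then have "card Q \<le> 2 * (2 * i + s)" using False s1 by auto
    also have "\<dots> \<le> 6 * i" using False by simp
    finally have "card Q \<le> 6 * i" .
    then show ?thesis unfolding Q_def .
  qed
qed

lemma W_iff: "a \<in> W j \<longleftrightarrow> int j = (t - a) div L"
proof -
  have "a \<in> W j \<longleftrightarrow> int j * L \<le> t - a \<and> t - a < (int j + 1) * L" by auto
  also have "\<dots> \<longleftrightarrow> int j = (t - a) div L"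
  proof
    assume "int j * L \<le> t - a \<and> t - a < (int j + 1) * L"
    then show "int j = (t - a) div L" using Lpos
      by (intro div_pos_pos_trivial[symmetric] int_div_pos_eq[symmetric, of _ _ _ "t - a - int j * L"]) (auto simp: algebra_simps)
  next
    assume j: "int j = (t - a) div L"
    show "int j * L \<le> t - a \<and> t - a < (int j + 1) * L"
      using Lpos div_mult_mod_eq[of "t - a" L] pos_mod_bound[of L "t - a"] pos_mod_sign[of L "t - a"]
      unfolding distrib_right j mult_1 by linarith
  qed
  finally show ?thesis .
qed

text \<open>AM-GM turns \<open>ln (1 + m / m')\<close> into \<open>ln 2 + (ln m - ln m') / 2\<close>, whose second part telescopes
  over consecutive windows.\<close>
lemma sum_window_ge:
  assumes G: "G \<ge> 1" and light: "card (W (Suc j) - A) \<le> G"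
  shows "ln 2 + (ln (real (min (card (W j - A)) G)) - ln (real (min (card (W (Suc j) - A)) G))) / 2
    \<le> (\<Sum>h \<in> {h \<in> W j - A. \<sigma> h \<le> 2 * G}. 1 / real (\<sigma> h))"
proof -
  define H where "H = W j - A"
  define c where "c = card (W (Suc j) - A)"
  \<comment> \<open>Truncating at \<open>G\<close> keeps only the first \<open>m\<close> holes of
    the window, for which \<open>\<sigma> h \<le> c + m \<le> 2 * G\<close>.\<close>
  define m where "m = min (card H) G"
  have W1: "card (W j - A) \<ge> 1" for j
    using window_meets_complement[of "t - int j * L"] by (simp add: algebra_simps)
  have c1: "c \<ge> 1" "c \<le> G" and m1: "m \<ge> 1" using W1[of j] W1[of "Suc j"] light G unfolding c_def m_def H_def by auto
  have fH: "finite H" unfolding H_def by auto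
  let ?rk = "\<lambda>h. card {x \<in> H. x < h}"
  \<comment> \<open>A hole within \<open>L\<close> to the left of \<open>h\<close> lies in the
    neighbouring window \<open>W (Suc j)\<close>, which has \<open>c\<close> holes, or is an earlier
    hole of the same window.\<close>
  have \<sigma>_le: "\<sigma> h \<le> c + ?rk h" if "h \<in> H" for h
  proof -
    have "{h-L..<h} - A \<subseteq> (W (Suc j) - A) \<union> {x \<in> H. x < h}"
      using that unfolding H_def by (auto simp: algebra_simps)
    then have "\<sigma> h \<le> card ((W (Suc j) - A) \<union> {x \<in> H. x < h})" using fH by (intro card_mono) auto
    also have "\<dots> \<le> c + ?rk h" unfolding c_def by (rule card_Un_le)
    finally show ?thesis .
  qed
  have \<sigma>_pos: "\<sigma> h \<ge> 1" for h using \<sigma>_ge[of h] window_meets_complement[of t] by linarith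
  have "ln (real (c + m) / real c) \<le> (\<Sum>r<m. 1 / real (c + r))" by (rule sum_inverse_ge_ln[OF c1(1)])
  also have "\<dots> = (\<Sum>h \<in> {h \<in> H. ?rk h < m}. 1 / real (c + ?rk h))"
  proof (rule sum.reindex_bij_betw[symmetric])
    have b: "bij_betw ?rk H {..<card H}" by (rule bij_betw_rank[OF fH])
    have "?rk ` {h \<in> H. ?rk h < m} = {..<m}"
    proof
      show "{..<m} \<subseteq> ?rk ` {h \<in> H. ?rk h < m}"
      proof
        fix r assume r: "r \<in> {..<m}"
        then have "r \<in> ?rk ` H" using b unfolding bij_betw_def m_def by auto
        with r show "r \<in> ?rk ` {h \<in> H. ?rk h < m}" by auto
      qed
    qed auto
    moreover have "inj_on ?rk {h \<in> H. ?rk h < m}" using b unfolding bij_betw_def by (auto intro: inj_on_subset)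
    ultimately show "bij_betw ?rk {h \<in> H. ?rk h < m} {..<m}" unfolding bij_betw_def by simp
  qed
  also have "\<dots> \<le> (\<Sum>h \<in> {h \<in> H. ?rk h < m}. 1 / real (\<sigma> h))"
  proof (rule sum_mono)
    fix h assume h: "h \<in> {h \<in> H. ?rk h < m}"
    then have "real (\<sigma> h) \<le> real (c + ?rk h)" using \<sigma>_le by (intro of_nat_mono) auto
    moreover have "real (\<sigma> h) > 0" using \<sigma>_pos[of h] by linarith
    ultimately show "1 / real (c + ?rk h) \<le> 1 / real (\<sigma> h)" by (intro divide_left_mono) auto
  qed
  also have "\<dots> \<le> (\<Sum>h \<in> {h \<in> H. \<sigma> h \<le> 2 * G}. 1 / real (\<sigma> h))"
  proof (rule sum_mono2)
    show "{h \<in> H. ?rk h < m} \<subseteq> {h \<in> H. \<sigma> h \<le> 2 * G}"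
    proof clarify
      fix h assume h: "h \<in> H" "?rk h < m"
      have "m \<le> G" unfolding m_def by simp
      then show "\<sigma> h \<le> 2 * G" using \<sigma>_le[OF h(1)] h(2) c1 by linarith
    qed
  qed (use fH in auto)
  finally have main: "ln (real (c + m) / real c) \<le> (\<Sum>h \<in> {h \<in> H. \<sigma> h \<le> 2 * G}. 1 / real (\<sigma> h))" .
  have "ln 2 + (ln (real m) - ln (real c)) / 2 = ln (2 * sqrt (real m / real c))"
    using c1 m1 by (simp add: ln_mult ln_sqrt ln_div)
  also have "\<dots> \<le> ln (real (c + m) / real c)"
  proof (rule ln_mono)
    define x where "x = sqrt (real m / real c)"
    have "x ^ 2 = real m / real c" unfolding x_def by simp
    then have "real (c + m) / real c = 1 + x ^ 2" using c1 by (simp add: field_simps)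
    moreover have "2 * x \<le> 1 + x ^ 2" using zero_le_power2[of "x - 1"] by (simp add: power2_diff)
    ultimately show "2 * x \<le> real (c + m) / real c" by simp
    show "0 < 2 * x" unfolding x_def using c1 m1 by simp
  qed
  finally have "ln 2 + (ln (real m) - ln (real c)) / 2 \<le> ln (real (c + m) / real c)" .
  then show ?thesis using main c1 unfolding m_def c_def H_def by (simp add: min_def)
qed

text \<open>When \<open>sum_window_ge\<close> is summed over the windows, each light one contributes
  \<open>ln 2\<close> and the rest telescopes to an end term of at most \<open>ln G / 2\<close>. The
  sum of \<open>1 / \<sigma> h\<close> on the other side is controlled by
  \<open>card_\<sigma>_le\<close> through partial summation.\<close>

lemma card_light_windows:
  assumes G: "G \<ge> 1" "4 * G \<le> card D"
  shows "real (card {j. j < M \<and> card (W (Suc j) - A) \<le> G}) * ln 2 \<le> 6 + 6 * ln (real (2 * G)) + ln (real G) / 2"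
proof -
  let ?m = "\<lambda>j. ln (real (min (card (W j - A)) G))"
  define Q where "Q = {h. h \<le> t \<and> h \<notin> A \<and> \<sigma> h \<le> 2 * G}"
  have W1: "card (W j - A) \<ge> 1" for j
    using window_meets_complement[of "t - int j * L"] by (simp add: algebra_simps)
  have finQ: "finite Q" unfolding Q_def using finite_\<sigma> cardD_le G by auto
  have \<sigma>_pos: "\<sigma> h \<ge> 1" for h using \<sigma>_ge[of h] window_meets_complement[of t] by linarith
  have step: "(if card (W (Suc j) - A) \<le> G then ln 2 else 0) + (?m j - ?m (Suc j)) / 2
     \<le> (\<Sum>h \<in> {h \<in> W j - A. \<sigma> h \<le> 2 * G}. 1 / real (\<sigma> h))" for j
  proof (cases "card (W (Suc j) - A) \<le> G")
    case True
    then show ?thesis using sum_window_ge[OF G(1) True] by simp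
  next
    case False
    \<comment> \<open>If \<open>W (Suc j)\<close> is heavy, its truncated count is the maximum
      \<open>G\<close>, so the telescoping term is nonpositive.\<close>
    have "?m j \<le> ?m (Suc j)" using False G W1[of j] by (intro ln_mono) auto
    moreover have "(\<Sum>h \<in> {h \<in> W j - A. \<sigma> h \<le> 2 * G}. 1 / real (\<sigma> h)) \<ge> 0" by (intro sum_nonneg) auto
    ultimately show ?thesis using False by simp
  qed
  have "real (card {j. j < M \<and> card (W (Suc j) - A) \<le> G}) * ln 2 + (?m 0 - ?m M) / 2
     = (\<Sum>j<M. (if card (W (Suc j) - A) \<le> G then ln 2 else 0) + (?m j - ?m (Suc j)) / 2)"
  proof -
    have "(\<Sum>j<M. (?m j - ?m (Suc j)) / 2) = (?m 0 - ?m M) / 2"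
      by (subst sum_divide_distrib[symmetric]) (subst sum_lessThan_telescope', simp)
    moreover have "(\<Sum>j<M. if card (W (Suc j) - A) \<le> G then ln 2 else 0)
        = real (card {j. j < M \<and> card (W (Suc j) - A) \<le> G}) * ln (2::real)"
      by (subst sum.inter_filter[symmetric]) (auto simp: lessThan_def conj_commute)
    ultimately show ?thesis by (simp add: sum.distrib)
  qed
  also have "\<dots> \<le> (\<Sum>j<M. \<Sum>h \<in> {h \<in> W j - A. \<sigma> h \<le> 2 * G}. 1 / real (\<sigma> h))"
    by (intro sum_mono step)
  also have "\<dots> = (\<Sum>h \<in> (\<Union>j<M. {h \<in> W j - A. \<sigma> h \<le> 2 * G}). 1 / real (\<sigma> h))"
  proof (rule sum.UNION_disjoint[symmetric])
    show "\<forall>i\<in>{..<M}. \<forall>j\<in>{..<M}. i \<noteq> j \<longrightarrow>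
      {h \<in> W i - A. \<sigma> h \<le> 2 * G} \<inter> {h \<in> W j - A. \<sigma> h \<le> 2 * G} = {}"
    proof (intro ballI impI)
      fix i j :: nat assume "i \<noteq> j"
      have "W i \<inter> W j = {}"
      proof (rule ccontr)
        assume "W i \<inter> W j \<noteq> {}"
        then obtain x where "x \<in> W i" "x \<in> W j" by blast
        then have "int i = int j" unfolding W_iff by simp
        then show False using \<open>i \<noteq> j\<close> by simp
      qed
      then show "{h \<in> W i - A. \<sigma> h \<le> 2 * G} \<inter> {h \<in> W j - A. \<sigma> h \<le> 2 * G} = {}" by blast
    qed
    show "\<forall>i\<in>{..<M}. finite {h \<in> W i - A. \<sigma> h \<le> 2 * G}"
      by (auto intro: finite_subset[OF _ finite_greaterThanAtMost_int])
  qed auto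
  also have "\<dots> \<le> (\<Sum>h\<in>Q. 1 / real (\<sigma> h))"
  proof (rule sum_mono2[OF finQ])
    show "(\<Union>j<M. {h \<in> W j - A. \<sigma> h \<le> 2 * G}) \<subseteq> Q"
    proof clarify
      fix h j assume h: "h \<in> W j" "h \<notin> A" "\<sigma> h \<le> 2 * G"
      have "int j * L \<ge> 0" using Lpos by simp
      then have "h \<le> t" using h(1) by auto
      then show "h \<in> Q" using h unfolding Q_def by blast
    qed
  qed auto
  also have "\<dots> \<le> 6 + 6 * ln (real (2 * G))"
  proof (rule sum_inverse_le_of_linear_count[OF finQ])
    show "1 \<le> \<sigma> h \<and> \<sigma> h \<le> 2 * G" if "h \<in> Q" for h using that \<sigma>_pos unfolding Q_def by auto
    show "1 \<le> 2 * G" using G by simp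
    show "card {h \<in> Q. \<sigma> h \<le> i} \<le> 6 * i" if "i \<le> 2 * G" for i
    proof -
      have "{h \<in> Q. \<sigma> h \<le> i} = {h. h \<le> t \<and> h \<notin> A \<and> \<sigma> h \<le> i}" using that unfolding Q_def by auto
      then show ?thesis using card_\<sigma>_le[of i] that G by simp
    qed
  qed
  finally have "real (card {j. j < M \<and> card (W (Suc j) - A) \<le> G}) * ln 2 + (?m 0 - ?m M) / 2
      \<le> 6 + 6 * ln (real (2 * G))" .
  moreover have "?m 0 \<ge> 0" using W1[of 0] G by (intro ln_ge_zero) auto
  moreover have "?m M \<le> ln (real G)" using W1[of M] G by (intro ln_mono) auto
  moreover have "a \<le> c + z / 2" if "a + (x - y) / 2 \<le> c" "x \<ge> 0" "y \<le> z" for a c x y z :: real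
    using that by (simp add: field_simps)
  ultimately show ?thesis by blast
qed

text \<open>The window containing such an \<open>a\<close> lies inside \<open>{a-L..a+L}\<close>, so
  it has at most \<open>G\<close> holes. All these \<open>a\<close> therefore lie in
  \<open>W 0\<close> or in one of the few light windows, each of size \<open>L\<close>.\<close>

lemma card_dense_left_le:
  assumes G: "G \<ge> 1" "4 * G \<le> card D"
  shows "real (card {a \<in> A. a \<le> t \<and> card ({a-L..a+L} - A) \<le> G})
    \<le> ((6 + 6 * ln (real (2 * G)) + ln (real G) / 2) / ln 2 + 1) * real_of_int L"
proof -
  define X where "X = {a \<in> A. a \<le> t \<and> card ({a-L..a+L} - A) \<le> G}"
  have finX: "finite X" unfolding X_def using finA by simp
  \<comment> \<open>The sum bounds every window index that occurs in \<open>X\<close>.\<close>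
  define M where "M = (\<Sum>a\<in>X. nat ((t - a) div L))"
  define J where "J = {j. j < M \<and> card (W (Suc j) - A) \<le> G}"
  have finJ: "finite J" unfolding J_def by auto
  have "X \<subseteq> W 0 \<union> (\<Union>j\<in>J. W (Suc j))"
  proof
    fix a assume a: "a \<in> X"
    define i where "i = nat ((t - a) div L)"
    have ge: "(t - a) div L \<ge> 0" using a Lpos unfolding X_def by (auto intro: pos_imp_zdiv_nonneg_iff[THEN iffD2])
    then have aW: "a \<in> W i" unfolding W_iff i_def by simp
    show "a \<in> W 0 \<union> (\<Union>j\<in>J. W (Suc j))"
    proof (cases i)
      case 0
      then show ?thesis using aW by simp
    next
      case (Suc j)
      have "i \<le> M" unfolding M_def i_def using a finX by (intro member_le_sum) auto
      moreover have "card (W i - A) \<le> card ({a-L..a+L} - A)"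
        using aW by (intro card_mono) (auto simp: algebra_simps)
      then have "card (W i - A) \<le> G" using a unfolding X_def by simp
      ultimately have "j \<in> J" unfolding J_def using Suc by simp
      then show ?thesis using aW Suc by auto
    qed
  qed
  then have "card X \<le> card (W 0 \<union> (\<Union>j\<in>J. W (Suc j)))" using finJ by (intro card_mono) auto
  also have "\<dots> \<le> card (W 0) + (\<Sum>j\<in>J. card (W (Suc j)))"
    by (rule order_trans[OF card_Un_le add_left_mono[OF card_UN_le[OF finJ]]])
  also have "\<dots> = nat L + card J * nat L" by (simp add: algebra_simps)
  finally have "real (card X) \<le> real (nat L + card J * nat L)" by (rule of_nat_mono)
  also have "\<dots> = (real (card J) + 1) * real_of_int L" using Lpos by (simp add: algebra_simps)
  also have "\<dots> \<le> ((6 + 6 * ln (real (2 * G)) + ln (real G) / 2) / ln 2 + 1) * real_of_int L"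
    using card_light_windows[OF G, of M] Lpos unfolding J_def
    by (intro mult_right_mono add_mono) (auto simp: field_simps)
  finally show ?thesis unfolding X_def .
qed

end

text \<open>Markov's inequality: summed over \<open>a\<close>, the counts give the sum of
  \<open>exits A d\<close> over \<open>D\<close>, which is at most
  \<open>card D * k\<close>.\<close>

lemma card_many_exits_le:
  fixes A D :: "int set"
  assumes "finite A" "finite D" "\<And>d. d \<in> D \<Longrightarrow> exits A d \<le> k" "k \<ge> 1"
  shows "card {a \<in> A. k \<le> 10 * card {d \<in> D. a + d \<notin> A}} \<le> 10 * card D"
proof -
  let ?X = "{a \<in> A. k \<le> 10 * card {d \<in> D. a + d \<notin> A}}"
  have "card ?X * k \<le> (\<Sum>a\<in>?X. 10 * card {d \<in> D. a + d \<notin> A})"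
    using sum_mono[of ?X "\<lambda>_. k" "\<lambda>a. 10 * card {d \<in> D. a + d \<notin> A}"] by simp
  also have "\<dots> \<le> 10 * (\<Sum>a\<in>A. card {d \<in> D. a + d \<notin> A})"
    unfolding sum_distrib_left using assms(1) by (intro sum_mono2) auto
  also have "(\<Sum>a\<in>A. card {d \<in> D. a + d \<notin> A}) = (\<Sum>d\<in>D. exits A d)"
    unfolding exits_def using assms by (intro sum_multicount_gen) auto
  also have "\<dots> \<le> card D * k" using sum_bounded_above[of D "exits A" k] assms by simp
  finally show ?thesis using assms(4) by (simp add: algebra_simps)
qed

lemma card_backward_exits_le:
  fixes A D :: "int set"
  assumes "finite A" "finite D" "\<And>d. d \<in> D \<Longrightarrow> exits A d \<le> k" "k \<ge> 1"
  shows "card {a \<in> A. k \<le> 10 * card {d \<in> D. a - d \<notin> A}} \<le> 10 * card D"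
proof -
  have "- a + d \<notin> uminus ` A \<longleftrightarrow> a - d \<notin> A" for a d by (auto simp: image_iff algebra_simps)
  then have "card {a \<in> A. k \<le> 10 * card {d \<in> D. a - d \<notin> A}}
    = card {a \<in> uminus ` A. k \<le> 10 * card {d \<in> D. a + d \<notin> uminus ` A}}"
    by (intro bij_betw_same_card[of uminus] bij_betw_byWitness[where f' = uminus]) auto
  then show ?thesis using card_many_exits_le[of "uminus ` A" D k] assms exits_reflect by simp
qed

section \<open>Reflection and the size bound for sets of integers\<close>

lemma card_window_reflect:
  fixes A :: "int set"
  shows "card ({x-L<..x} - uminus ` A) = card ({(L-x-1)-L<..L-x-1} - A)"
  by (intro bij_betw_same_card[of uminus] bij_betw_byWitness[where f' = uminus]) force+

text \<open>An element of \<open>A\<close> either has at most \<open>G\<close> holes around it, and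
  is then counted to the left or to the right of \<open>t\<close>, or has at least
  \<open>k / 10\<close> forward or backward exits with differences in \<open>D\<close>, which Markov
  limits. As \<open>D\<close> fills almost all of \<open>{1..L}\<close>, there is no other
  element.\<close>

lemma card_le_of_few_exits:
  assumes fin: "finite A" and D: "D \<subseteq> {1..L}" "L \<in> D" "k + 1 \<le> card D"
    and Lk: "real_of_int L \<le> 101 / 100 * real k"
    and ex: "\<And>d. d \<in> D \<Longrightarrow> exits A d \<le> k"
  shows "real (card A) \<le> 50 * real k * (1 + ln (real k))"
proof -
  have finD: "finite D" using D finite_subset by blast
  have Lpos: "L \<ge> 1" using D by auto
  have fL: "int (card D) \<le> L" using card_mono[OF _ D(1)] Lpos by auto
  have "real k + 1 \<le> real_of_int L" using fL D(3) by linarith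
  then have k100: "k \<ge> 100" using Lk by linarith
  \<comment> \<open>About a quarter of \<open>k\<close>: more than the \<open>k / 5\<close> plus
    \<open>2 * (L - card D)\<close> holes possible around an element outside all four sets below,
    thanks to \<open>L \<le> 1.01 k\<close>.\<close>
  define G where "G = card D div 4"
  have G: "G \<ge> 1" "4 * G \<le> card D" "card D \<le> 4 * G + 3" unfolding G_def using D k100 by linarith+
  obtain t where t: "\<And>x. card ({t-L<..t} - A) \<le> card ({x-L<..x} - A)"
    using ex_has_least_nat[of "\<lambda>_. True" 0 "\<lambda>x. card ({x-L<..x} - A)"] by auto
  interpret left: sparse_exits A D L t k
    by unfold_locales (use fin D ex t in auto)
  \<comment> \<open>The sparsest window of the reflected set is the mirror image of the one ending
    at \<open>t\<close>; it ends at \<open>L - t - 1\<close>.\<close>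
  interpret right: sparse_exits "uminus ` A" D L "L - t - 1" k
  proof unfold_locales
    fix x
    have "card ({L-t-1-L<..L-t-1} - uminus ` A) = card ({t-L<..t} - A)"
      by (subst card_window_reflect) simp
    also have "\<dots> \<le> card ({(L-x-1)-L<..L-x-1} - A)" by (rule t)
    also have "\<dots> = card ({x-L<..x} - uminus ` A)" by (rule card_window_reflect[symmetric])
    finally show "card ({L-t-1-L<..L-t-1} - uminus ` A) \<le> card ({x-L<..x} - uminus ` A)" .
  qed (use fin D ex exits_reflect[OF fin] in auto)
  define K where "K = ((6 + 6 * ln (real (2 * G)) + ln (real G) / 2) / ln 2 + 1) * real_of_int L"
  define X1 where "X1 = {a \<in> A. a \<le> t \<and> card ({a-L..a+L} - A) \<le> G}"
  define X2 where "X2 = {a \<in> A. - a \<le> L - t - 1 \<and> card ({a-L..a+L} - A) \<le> G}"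
  define Y1 where "Y1 = {a \<in> A. k \<le> 10 * card {d \<in> D. a + d \<notin> A}}"
  define Y2 where "Y2 = {a \<in> A. k \<le> 10 * card {d \<in> D. a - d \<notin> A}}"
  have X1: "real (card X1) \<le> K"
    unfolding X1_def K_def by (rule left.card_dense_left_le[OF G(1,2)])
  have X2: "real (card X2) \<le> K"
  proof -
    have "card ({-a-L..-a+L} - uminus ` A) = card ({a-L..a+L} - A)" for a
      by (intro bij_betw_same_card[of uminus] bij_betw_byWitness[where f' = uminus]) force+
    then have "card X2 = card {a \<in> uminus ` A. a \<le> L - t - 1 \<and> card ({a-L..a+L} - uminus ` A) \<le> G}"
      unfolding X2_def by (intro bij_betw_same_card[of uminus] bij_betw_byWitness[where f' = uminus]) auto
    then show ?thesis unfolding K_def using right.card_dense_left_le[OF G(1,2)] by simp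
  qed
  have Y: "card Y1 \<le> 10 * card D" "card Y2 \<le> 10 * card D"
    unfolding Y1_def Y2_def
    using card_many_exits_le[OF fin finD ex] card_backward_exits_le[OF fin finD ex] k100 by auto
  have "A \<subseteq> (X1 \<union> X2) \<union> (Y1 \<union> Y2)"
  proof
    fix a assume a: "a \<in> A"
    show "a \<in> (X1 \<union> X2) \<union> (Y1 \<union> Y2)"
    proof (rule ccontr)
      assume n: "\<not> ?thesis"
      define u where "u = card {d \<in> D. a + d \<notin> A}"
      define v where "v = card {d \<in> D. a - d \<notin> A}"
      have "a \<le> t \<or> - a \<le> L - t - 1" using Lpos by linarith
      then have "card ({a-L..a+L} - A) > G" using n a unfolding X1_def X2_def by auto
      have uv: "10 * u < k" "10 * v < k" using n a unfolding Y1_def Y2_def u_def v_def by auto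
      \<comment> \<open>A hole near \<open>a\<close> is at a distance in \<open>D\<close>, hence
        counted by \<open>u\<close> or \<open>v\<close>, or at one of the \<open>L - card D\<close>
        distances missing from \<open>D\<close>.\<close>
      have "{a-L..a+L} - A \<subseteq> ((\<lambda>d. a + d) ` {d \<in> D. a + d \<notin> A} \<union> (\<lambda>d. a - d) ` {d \<in> D. a - d \<notin> A})
          \<union> ((\<lambda>d. a + d) ` ({1..L} - D) \<union> (\<lambda>d. a - d) ` ({1..L} - D))" (is "_ \<subseteq> ?R")
      proof
        fix x assume x: "x \<in> {a-L..a+L} - A"
        then have "x \<noteq> a" using a by auto
        then consider "x - a \<ge> 1" | "a - x \<ge> 1" by linarith
        then show "x \<in> ?R"
        proof cases
          case 1
          have "x = a + (x - a)" by simp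
          then show ?thesis using x 1 by (cases "x - a \<in> D") (auto intro!: image_eqI[of _ _ "x - a"])
        next
          case 2
          have "x = a - (a - x)" by simp
          then show ?thesis using x 2 by (cases "a - x \<in> D") (auto intro!: image_eqI[of _ _ "a - x"])
        qed
      qed
      then have "card ({a-L..a+L} - A) \<le> card ?R" using finD by (intro card_mono) auto
      also have "\<dots> \<le> (u + v) + (card ({1..L} - D) + card ({1..L} - D))"
        unfolding u_def v_def using finD
        by (intro order_trans[OF card_Un_le] add_mono card_image_le) auto
      also have "card ({1..L} - D) = nat L - card D"
        using card_Diff_subset[OF finD D(1)] by simp
      finally have "int G < int u + int v + 2 * L - 2 * int (card D)"
        using \<open>card ({a-L..a+L} - A) > G\<close> fL Lpos by linarith
      then have "real G < real u + real v + 2 * real_of_int L - 2 * real (card D)" by linarith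
      moreover have "10 * real u \<le> real k" "10 * real v \<le> real k" using uv by linarith+
      moreover have "real k + 1 \<le> real (card D)" "real (card D) \<le> 4 * real G + 3" using D(3) G(3) by linarith+
      ultimately show False using Lk by linarith
    qed
  qed
  then have "card A \<le> card ((X1 \<union> X2) \<union> (Y1 \<union> Y2))"
    using fin unfolding X1_def X2_def Y1_def Y2_def by (intro card_mono) auto
  also have "\<dots> \<le> (card X1 + card X2) + (card Y1 + card Y2)"
    by (intro order_trans[OF card_Un_le] add_mono card_Un_le)
  finally have nA: "real (card A) \<le> 2 * K + 20 * real (card D)" using X1 X2 Y by linarith
  have lnk: "ln (real k) \<ge> 0" using k100 by (intro ln_ge_zero) auto
  have "real (card D) \<le> 101 / 100 * real k" using fL Lk by linarith
  have "real (4 * G) \<le> real (card D)" using G by (intro of_nat_mono) auto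
  then have "real (2 * G) \<le> real k" "real G \<le> real k"
    using \<open>real (card D) \<le> 101 / 100 * real k\<close> by auto
  then have "ln (real (2 * G)) \<le> ln (real k)" "ln (real G) \<le> ln (real k)"
    using G(1) by (intro ln_mono; simp)+
  then have "6 + 6 * ln (real (2 * G)) + ln (real G) / 2 \<le> 6 + 13 / 2 * ln (real k)" by linarith
  also have "\<dots> \<le> (12 + 13 * ln (real k)) * ln 2"
  proof -
    have "ln (2::real) \<ge> 1 / 2" using ln_le_minus_one[of "1 / 2"] by (simp add: ln_div)
    then show ?thesis
      using mult_left_mono[of "1 / 2" "ln 2" "12 + 13 * ln (real k)"] lnk by (simp add: algebra_simps)
  qed
  finally have "(6 + 6 * ln (real (2 * G)) + ln (real G) / 2) / ln 2 \<le> 12 + 13 * ln (real k)"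
    by (simp add: pos_divide_le_eq)
  then have "K \<le> (13 + 13 * ln (real k)) * (101 / 100 * real k)"
    unfolding K_def using Lk Lpos lnk by (intro mult_mono) auto
  also have "\<dots> \<le> 1313 / 100 * real k + 14 * (real k * ln (real k))"
  proof -
    have "real k * ln (real k) \<ge> 0" using lnk by simp
    then show ?thesis by (simp add: algebra_simps)
  qed
  finally have "real (card A) \<le> 50 * real k + 28 * (real k * ln (real k))"
    using nA \<open>real (card D) \<le> 101 / 100 * real k\<close> by linarith
  also have "\<dots> \<le> 50 * real k * (1 + ln (real k))"
  proof -
    have "real k * ln (real k) \<ge> 0" using lnk by simp
    then show ?thesis by (simp add: algebra_simps)
  qed
  finally show ?thesis .
qed

section \<open>Shifts of a set of residues\<close>

text \<open>The real part of the geometric sum of the powers of a root of unity.\<close>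

lemma sum_cos_roots_of_unity:
  fixes p y :: int
  assumes "p > 0"
  shows "(\<Sum>r\<in>{0..<p}. cos (2 * pi * real_of_int r * real_of_int y / real_of_int p)) = (if p dvd y then real_of_int p else 0)"
proof -
  define z where "z = cis (2 * pi * real_of_int y / real_of_int p)"
  define q where "q = nat p"
  have q: "p = int q" "q > 0" using assms unfolding q_def by auto
  have zr: "z ^ r = cis (2 * pi * real r * real_of_int y / real_of_int p)" for r
    unfolding z_def by (simp add: DeMoivre mult_ac)
  have "(\<Sum>r\<in>{0..<p}. cos (2 * pi * real_of_int r * real_of_int y / real_of_int p))
      = (\<Sum>r<q. cos (2 * pi * real r * real_of_int y / real_of_int p))"
  proof (rule sum.reindex_bij_witness[of _ int nat])
  qed (auto simp: q)
  also have "\<dots> = Re (\<Sum>r<q. z ^ r)" by (simp add: zr)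
  also have "\<dots> = (if p dvd y then real_of_int p else 0)"
  proof (cases "p dvd y")
    case True
    then obtain c where "y = p * c" by blast
    then have "2 * pi * real_of_int y / real_of_int p = 2 * pi * real_of_int c" using assms by simp
    then have "z = 1" unfolding z_def by (simp only:) (rule cis_multiple_2pi, simp)
    then show ?thesis using True q by simp
  next
    case False
    have "z \<noteq> 1"
    proof
      assume "z = 1"
      then have "cos (2 * pi * real_of_int y / real_of_int p) = 1" unfolding z_def by (simp add: complex_eq_iff)
      then obtain c :: int where "2 * pi * real_of_int y / real_of_int p = real_of_int c * 2 * pi"
        using cos_one_2pi_int by blast
      then have "real_of_int y = real_of_int (c * p)" using assms by (simp add: field_simps)
      then have "y = c * p" by (simp only: of_int_eq_iff)
      then show False using False by simp
    qed
    moreover have "2 * pi * real q * real_of_int y / real_of_int p = 2 * pi * real_of_int y" using q by simp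
    then have "z ^ q = 1" unfolding zr by (simp only:) (rule cis_multiple_2pi, simp)
    ultimately show ?thesis using False by (simp add: sum_gp_strict lessThan_Suc_atMost)
  qed
  finally show ?thesis .
qed

section \<open>Counting shifts modulo a prime\<close>

locale cyclic_set =
  fixes p :: int and A :: "int set"
  assumes prime_p: "prime p" and A: "A \<subseteq> {0..<p}"
begin

text \<open>The cyclic analogue of \<open>exits\<close>. The argument is any integer and only its
  residue matters, so differences can be inserted unreduced.\<close>

definition \<delta> :: "int \<Rightarrow> nat" where "\<delta> x = card {a \<in> A. (a + x) mod p \<notin> A}"
definition n :: nat where "n = card A"

lemma p_pos: "p > 0" using prime_p prime_gt_0_int by blast
lemma finA: "finite A" using A finite_subset by blast
lemma mod_A: "a \<in> A \<Longrightarrow> a mod p = a" using A by auto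

lemma inj_shift: "inj_on (\<lambda>a. (a + x) mod p) {0..<p}"
proof (rule inj_onI)
  fix a b assume ab: "a \<in> {0..<p}" "b \<in> {0..<p}" "(a + x) mod p = (b + x) mod p"
  then have "p dvd a - b" by (simp add: mod_eq_dvd_iff)
  then have "a mod p = b mod p" by (simp add: mod_eq_dvd_iff)
  then show "a = b" using ab by simp
qed

lemma \<delta>_mod: "\<delta> (x mod p) = \<delta> x"
  unfolding \<delta>_def by (simp add: mod_add_right_eq)

lemma \<delta>_cong: "x mod p = y mod p \<Longrightarrow> \<delta> x = \<delta> y"
  using \<delta>_mod by metis

lemma \<delta>_0: "\<delta> 0 = 0"
  unfolding \<delta>_def using mod_A by (auto intro: card_eq_0_iff[THEN iffD2])

lemma \<delta>_le: "\<delta> x \<le> n"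
  unfolding \<delta>_def n_def using finA by (intro card_mono) auto

lemma card_return: "card {a \<in> A. (a + x) mod p \<in> A} = n - \<delta> x"
  using card_filter_add_not[OF finA, of "\<lambda>a. (a + x) mod p \<in> A"] unfolding \<delta>_def n_def by linarith

lemma \<delta>_minus: "\<delta> (- x) = \<delta> x"
proof -
  have "card {a \<in> A. (a + x) mod p \<in> A} = card {a \<in> A. (a - x) mod p \<in> A}"
  proof (rule bij_betw_same_card, rule bij_betw_byWitness[where f = "\<lambda>a. (a + x) mod p" and f' = "\<lambda>a. (a - x) mod p"])
    show "\<forall>a\<in>{a \<in> A. (a + x) mod p \<in> A}. ((a + x) mod p - x) mod p = a"
      by (auto simp: mod_diff_left_eq mod_A)
    show "\<forall>a\<in>{a \<in> A. (a - x) mod p \<in> A}. ((a - x) mod p + x) mod p = a"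
      by (auto simp: mod_add_left_eq mod_A)
  qed (auto simp: mod_diff_left_eq mod_add_left_eq mod_A)
  then have "n - \<delta> x = n - \<delta> (- x)" using card_return[of x] card_return[of "- x"] by simp
  then show ?thesis using \<delta>_le[of x] \<delta>_le[of "- x"] by linarith
qed

text \<open>An \<open>a\<close> that exits under \<open>x + y\<close> exits under \<open>x\<close>,
  or else \<open>a + x\<close> is in \<open>A\<close> and exits under \<open>y\<close>.\<close>

lemma \<delta>_add: "\<delta> (x + y) \<le> \<delta> x + \<delta> y"
proof -
  let ?U = "{a \<in> A. (a + x) mod p \<notin> A}" and ?V = "{a \<in> A. (a + x) mod p \<in> A \<and> (a + (x + y)) mod p \<notin> A}"
  have "\<delta> (x + y) \<le> card (?U \<union> ?V)" unfolding \<delta>_def using finA by (intro card_mono) auto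
  also have "\<dots> \<le> card ?U + card ?V" by (rule card_Un_le)
  also have "card ?V \<le> \<delta> y" unfolding \<delta>_def
  proof (rule card_inj_on_le[of "\<lambda>a. (a + x) mod p"])
    show "inj_on (\<lambda>a. (a + x) mod p) ?V" by (rule inj_on_subset[OF inj_shift]) (use A in auto)
    show "(\<lambda>a. (a + x) mod p) ` ?V \<subseteq> {a \<in> A. (a + y) mod p \<notin> A}"
      by (auto simp: mod_add_left_eq add.assoc)
  qed (use finA in auto)
  finally show ?thesis unfolding \<delta>_def by linarith
qed

lemma \<delta>_diff: "\<delta> (x - y) \<le> \<delta> x + \<delta> y"
  using \<delta>_add[of x "- y"] \<delta>_minus[of y] by simp

lemma \<delta>_mult: "\<delta> (q * x) \<le> nat \<bar>q\<bar> * \<delta> x"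
proof -
  have *: "\<delta> (int i * x) \<le> i * \<delta> x" for i
  proof (induction i)
    case (Suc i)
    have "int (Suc i) * x = int i * x + x" by (simp add: algebra_simps)
    then show ?case using Suc \<delta>_add[of "int i * x" x] by simp
  qed (simp add: \<delta>_0)
  show ?thesis
  proof (cases "q \<ge> 0")
    case True
    then show ?thesis using *[of "nat q"] by simp
  next
    case False
    then have "q * x = - (int (nat \<bar>q\<bar>) * x)" by simp
    then show ?thesis using *[of "nat \<bar>q\<bar>"] \<delta>_minus by metis
  qed
qed

text \<open>\<open>n - \<delta> x\<close> counts the pairs in \<open>A \<times> A\<close> with
  difference \<open>x\<close>, and each pair is counted for at most one residue.\<close>

lemma sum_return_le:
  assumes "finite X" "inj_on (\<lambda>x. x mod p) X"
  shows "(\<Sum>x\<in>X. real n - real (\<delta> x)) \<le> real n ^ 2"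
proof -
  have "(\<Sum>x\<in>X. card {a \<in> A. (a + x) mod p \<in> A}) = (\<Sum>a\<in>A. card {x \<in> X. (a + x) mod p \<in> A})"
    using assms finA by (intro sum_multicount_gen[symmetric]) auto
  also have "\<dots> \<le> card A * card A"
  proof (rule order_trans[OF sum_bounded_above])
    fix a assume "a \<in> A"
    show "card {x \<in> X. (a + x) mod p \<in> A} \<le> card A"
    proof (rule card_inj_on_le[of "\<lambda>x. (a + x) mod p"])
      show "inj_on (\<lambda>x. (a + x) mod p) {x \<in> X. (a + x) mod p \<in> A}"
      proof (rule inj_onI)
        fix x y assume xy: "x \<in> {x \<in> X. (a + x) mod p \<in> A}" "y \<in> {x \<in> X. (a + x) mod p \<in> A}"
          "(a + x) mod p = (a + y) mod p"
        then have "x mod p = y mod p" by (simp add: mod_eq_dvd_iff)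
        then show "x = y" using assms(2) xy unfolding inj_on_def by blast
      qed
    qed (use finA in auto)
  qed simp
  finally have "real (\<Sum>x\<in>X. card {a \<in> A. (a + x) mod p \<in> A}) \<le> real (card A * card A)" by (rule of_nat_mono)
  moreover have "real (\<Sum>x\<in>X. card {a \<in> A. (a + x) mod p \<in> A}) = (\<Sum>x\<in>X. real n - real (\<delta> x))"
    unfolding card_return using \<delta>_le by (simp add: of_nat_diff)
  ultimately show ?thesis unfolding n_def by (simp add: power2_eq_square)
qed

section \<open>Level sets of \<open>\<delta>\<close> and their growth\<close>

definition lev :: "nat \<Rightarrow> int set" where "lev t = {x \<in> {0..<p}. \<delta> x \<le> t}"

lemma finite_lev [simp]: "finite (lev t)"
  by (rule finite_subset[of _ "{0..<p}"]) (auto simp: lev_def)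

lemma inj_mod_residues: "inj_on (\<lambda>x. x mod p) {0..<p}"
  using inj_shift[of 0] by simp

text \<open>Every point of the level set contributes at least \<open>n / 2\<close> to a sum that is
  at most \<open>n ^ 2\<close>.\<close>

lemma card_lev_le: "2 * s \<le> n \<Longrightarrow> n > 0 \<Longrightarrow> card (lev s) \<le> 2 * n"
proof -
  assume s: "2 * s \<le> n" and n0: "n > 0"
  have "real (card (lev s)) * (real n / 2) \<le> (\<Sum>x\<in>lev s. real n - real (\<delta> x))"
  proof (rule sum_bounded_below)
    fix x assume "x \<in> lev s"
    then have "2 * real (\<delta> x) \<le> real n" using s unfolding lev_def by auto
    then show "real n / 2 \<le> real n - real (\<delta> x)" by simp
  qed
  also have "\<dots> \<le> real n ^ 2"
    by (intro sum_return_le inj_on_subset[OF inj_mod_residues] finite_lev) (auto simp: lev_def)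
  finally have "real (card (lev s)) \<le> real (2 * n)" using n0 by (simp add: power2_eq_square)
  then show ?thesis by (simp only: of_nat_le_iff)
qed

text \<open>Walking along the multiples of \<open>g\<close> one meets a point \<open>z\<close> just outside the level set \<open>lev s\<close>;
  the translate \<open>z + lev t\<close> then avoids \<open>lev (s - t)\<close>.\<close>
lemma card_lev_add:
  assumes g: "g \<in> {1..<p}" "\<delta> g \<le> t" and s: "t \<le> s" "lev s \<noteq> {0..<p}"
  shows "card (lev (s - t)) + card (lev t) \<le> card (lev (s + 2 * t))"
proof -
  obtain y where y: "y \<in> {0..<p}" "\<delta> y > s" using s(2) unfolding lev_def by force
  \<comment> \<open>A nonzero \<open>g\<close> generates the group of prime order, so some multiple
    of \<open>g\<close> reaches \<open>y\<close>, outside \<open>lev s\<close>. The first multiple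
    outside has \<open>\<delta>\<close> at most \<open>s + t\<close>.\<close>
  have "coprime g p" using g prime_p by (metis coprime_commute atLeastLessThan_iff prime_imp_coprime zdvd_not_zless zless_iff_Suc_zadd zero_less_one order_less_le_trans)
  then obtain x where x: "[g * x = 1] (mod p)" using cong_solve_coprime_int by blast
  define i0 where "i0 = nat ((x * y) mod p)"
  have "int i0 = (x * y) mod p" unfolding i0_def using p_pos by simp
  then have "[int i0 * g = y] (mod p)"
    using cong_mult[OF x cong_refl[of y]] unfolding cong_def
    by (simp add: mod_mult_right_eq mult_ac)
  then have "\<delta> (int i0 * g) = \<delta> y" unfolding cong_def by (rule \<delta>_cong)
  then have i0: "\<delta> (int i0 * g) > s" using y by simp
  define j where "j = (LEAST i. \<delta> (int i * g) > s)"
  have j: "\<delta> (int j * g) > s" unfolding j_def using i0 by (rule LeastI)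
  then have "j \<noteq> 0" using \<delta>_0 by (cases j) auto
  then obtain i where i: "j = Suc i" by (cases j) auto
  have "\<not> \<delta> (int i * g) > s" using i not_less_Least[of i "\<lambda>i. \<delta> (int i * g) > s"] unfolding j_def by simp
  moreover have "int j * g = int i * g + g" unfolding i by (simp add: algebra_simps)
  ultimately have j2: "\<delta> (int j * g) \<le> s + t" using \<delta>_add[of "int i * g" g] g(2) by simp
  let ?f = "\<lambda>x. (x + int j * g) mod p"
  have "card (lev t) = card (?f ` lev t)"
    by (rule card_image[symmetric], rule inj_on_subset[OF inj_shift]) (auto simp: lev_def)
  moreover have "?f ` lev t \<inter> lev (s - t) = {}"
  proof (rule ccontr)
    assume "?f ` lev t \<inter> lev (s - t) \<noteq> {}"
    then obtain x where x: "x \<in> lev t" "?f x \<in> lev (s - t)" by blast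
    then have "\<delta> (x + int j * g) \<le> s - t" "\<delta> x \<le> t" unfolding lev_def using \<delta>_mod by auto
    then have "\<delta> (int j * g) \<le> s" using \<delta>_diff[of "x + int j * g" x] s(1) by simp
    then show False using j by simp
  qed
  moreover have "?f ` lev t \<union> lev (s - t) \<subseteq> lev (s + 2 * t)"
  proof
    fix z assume z: "z \<in> ?f ` lev t \<union> lev (s - t)"
    show "z \<in> lev (s + 2 * t)"
    proof (cases "z \<in> lev (s - t)")
      case True
      then show ?thesis unfolding lev_def by auto
    next
      case False
      then obtain x where x: "x \<in> lev t" "z = ?f x" using z by blast
      then have "\<delta> z \<le> \<delta> x + \<delta> (int j * g)" using \<delta>_mod \<delta>_add by metis
      then show ?thesis using x j2 p_pos unfolding lev_def by auto
    qed
  qed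
  ultimately show ?thesis
    using card_Un_disjoint[of "?f ` lev t" "lev (s - t)"] card_mono[OF finite_lev, of "?f ` lev t \<union> lev (s - t)" "s + 2 * t"]
    by simp
qed

text \<open>By \<open>card_lev_add\<close>, raising the level by \<open>3 * t\<close> adds
  \<open>card (lev t)\<close> points. This can be repeated about \<open>n / (6 * t)\<close> times
  before level \<open>n / 2\<close>, where \<open>card_lev_le\<close> caps the size at
  \<open>2 * n\<close>.\<close>

lemma card_lev_le_linear:
  assumes t: "t \<ge> 1" "6 * t \<le> n" and np: "2 * int n < p"
  shows "card (lev t) \<le> 24 * t"
proof (cases "lev t \<subseteq> {0}")
  case True
  then have "card (lev t) \<le> card {0::int}" by (intro card_mono) auto
  then show ?thesis using t by simp
next
  case False
  then obtain g where "g \<in> lev t" "g \<noteq> 0" by blast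
  then have g: "g \<in> {1..<p}" "\<delta> g \<le> t" unfolding lev_def by auto
  have n0: "n > 0" using t by simp
  have ne: "lev s \<noteq> {0..<p}" if "2 * s \<le> n" for s
    using card_lev_le[OF that n0] np by auto
  have grow: "6 * i * t \<le> n \<Longrightarrow> i * card (lev t) \<le> card (lev (3 * i * t))" for i
  proof (induction i)
    case (Suc i)
    have "card (lev (3 * i * t + t - t)) + card (lev t) \<le> card (lev (3 * i * t + t + 2 * t))"
      using Suc.prems by (intro card_lev_add[OF g] ne) (auto simp: algebra_simps)
    then show ?case using Suc by (simp add: algebra_simps)
  qed simp
  define i where "i = n div (6 * t)"
  have i: "6 * i * t \<le> n" "n < 6 * (i + 1) * t"
    unfolding i_def using t div_times_less_eq_dividend[of n "6 * t"] dividend_less_div_times[of "6 * t" n]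
    by (auto simp: algebra_simps)
  have i1: "i \<ge> 1" unfolding i_def using t by (simp add: div_greater_zero_iff Suc_le_eq)
  have "i * card (lev t) \<le> 2 * n"
    using grow[OF i(1)] card_lev_le[of "3 * i * t"] i(1) n0 by simp
  also have "\<dots> \<le> 2 * (6 * (i + 1) * t)" using i by simp
  also have "\<dots> \<le> 2 * (6 * (i + i) * t)" using i1 by simp
  finally have "i * card (lev t) \<le> i * (24 * t)" by simp
  then show ?thesis using i1 by simp
qed

lemma card_le_linear:
  assumes t: "t \<ge> 1" "6 * t \<le> n" and np: "2 * int n < p"
    and X: "inj_on (\<lambda>x. x mod p) X" "\<And>x. x \<in> X \<Longrightarrow> \<delta> x \<le> t"
  shows "card X \<le> 24 * t"
proof -
  have "(\<lambda>x. x mod p) ` X \<subseteq> lev t" using X(2) \<delta>_mod p_pos by (auto simp: lev_def)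
  then have "card X \<le> card (lev t)" by (rule card_inj_on_le[OF X(1) _ finite_lev])
  then show ?thesis using card_lev_le_linear[OF t np] by linarith
qed

text \<open>\<open>fourier_weight r\<close> is the squared modulus of the \<open>r\<close>-th Fourier coefficient of the
  indicator function of \<open>A\<close>.\<close>
definition fourier_weight :: "int \<Rightarrow> real" where
  "fourier_weight r = (\<Sum>a\<in>A. cos (2 * pi * r * a / p))\<^sup>2 + (\<Sum>a\<in>A. sin (2 * pi * r * a / p))\<^sup>2"

section \<open>Fourier expansion of \<open>\<delta>\<close>\<close>

lemma fourier_weight_mult_cos:
  "fourier_weight r * cos (2 * pi * r * x / p) = (\<Sum>a\<in>A. \<Sum>b\<in>A. cos (2 * pi * r * (a + x - b) / p))"
proof -
  define \<theta> where "\<theta> = 2 * pi * real_of_int r / real_of_int p"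
  define C where "C = (\<Sum>a\<in>A. cos (\<theta> * real_of_int a))"
  define S where "S = (\<Sum>a\<in>A. sin (\<theta> * real_of_int a))"
  have exp: "cos (2 * pi * r * (a + x - b) / p)
      = cos (\<theta> * x) * (cos (\<theta> * a) * cos (\<theta> * b)) + cos (\<theta> * x) * (sin (\<theta> * a) * sin (\<theta> * b))
        - sin (\<theta> * x) * (sin (\<theta> * a) * cos (\<theta> * b)) + sin (\<theta> * x) * (cos (\<theta> * a) * sin (\<theta> * b))" for a b :: int
  proof -
    have "2 * pi * r * (a + x - b) / p = \<theta> * x + (\<theta> * a - \<theta> * b)"
      unfolding \<theta>_def by (simp add: algebra_simps add_divide_distrib diff_divide_distrib)
    then show ?thesis by (simp only: cos_add cos_diff sin_diff) (simp add: algebra_simps)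
  qed
  have dbl: "(\<Sum>a\<in>A. \<Sum>b\<in>A. c * (f a * g b)) = c * (sum f A * sum g A)" for c :: real and f g :: "int \<Rightarrow> real"
    unfolding sum_product by (simp add: sum_distrib_left)
  have "(\<Sum>a\<in>A. \<Sum>b\<in>A. cos (2 * pi * r * (a + x - b) / p))
      = cos (\<theta> * x) * (C * C) + cos (\<theta> * x) * (S * S) - sin (\<theta> * x) * (S * C) + sin (\<theta> * x) * (C * S)"
    unfolding exp sum.distrib sum_subtractf dbl C_def S_def by simp
  also have "\<dots> = (C\<^sup>2 + S\<^sup>2) * cos (\<theta> * x)" by (simp add: algebra_simps power2_eq_square)
  also have "\<dots> = fourier_weight r * cos (2 * pi * r * x / p)"
    unfolding fourier_weight_def C_def S_def \<theta>_def by simp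
  finally show ?thesis by simp
qed

text \<open>Orthogonality keeps exactly the pairs with \<open>b = a + x\<close> modulo
  \<open>p\<close>; up to normalisation the weights are the Fourier coefficients of the
  autocorrelation of \<open>A\<close>.\<close>

lemma sum_fourier_weight_mult_cos:
  "(\<Sum>r\<in>{0..<p}. fourier_weight r * cos (2 * pi * r * x / p)) = p * (real n - real (\<delta> x))"
proof -
  have "(\<Sum>r\<in>{0..<p}. fourier_weight r * cos (2 * pi * r * x / p))
      = (\<Sum>r\<in>{0..<p}. \<Sum>a\<in>A. \<Sum>b\<in>A. cos (2 * pi * r * real_of_int (a + x - b) / p))"
    by (simp add: fourier_weight_mult_cos)
  also have "\<dots> = (\<Sum>a\<in>A. \<Sum>b\<in>A. \<Sum>r\<in>{0..<p}. cos (2 * pi * r * real_of_int (a + x - b) / p))"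
    by (subst sum.swap, subst (2) sum.swap, rule refl)
  also have "\<dots> = (\<Sum>a\<in>A. \<Sum>b\<in>A. if b = (a + x) mod p then real_of_int p else 0)"
  proof (intro sum.cong refl)
    fix a b assume "a \<in> A" "b \<in> A"
    have "p dvd a + x - b \<longleftrightarrow> b = (a + x) mod p"
      using mod_A[OF \<open>b \<in> A\<close>] by (metis mod_eq_dvd_iff)
    then show "(\<Sum>r\<in>{0..<p}. cos (2 * pi * r * real_of_int (a + x - b) / p))
        = (if b = (a + x) mod p then real_of_int p else 0)"
      using sum_cos_roots_of_unity[OF p_pos, of "a + x - b"] by simp
  qed
  also have "\<dots> = (\<Sum>a\<in>A. if (a + x) mod p \<in> A then real_of_int p else 0)"
    using finA by simp
  also have "\<dots> = p * real (card {a \<in> A. (a + x) mod p \<in> A})"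
    using finA by (subst sum.inter_filter[symmetric]) auto
  finally show ?thesis unfolding card_return using \<delta>_le by (simp add: of_nat_diff)
qed

text \<open>Averaging with the Fourier weights: the weighted sum of \<open>V r\<close> is
  \<open>p\<close> times a sum of values \<open>\<delta> (b - c) \<le> k\<close>. The trivial
  frequency carries weight \<open>n ^ 2\<close>, less than half of the total \<open>p * n\<close>,
  so some nontrivial \<open>r\<close> loses at most a factor \<open>2\<close> against the average. A
  second averaging selects \<open>c\<close>.\<close>

lemma ex_concentrating_frequency:
  fixes B :: "int set"
  assumes B: "finite B" "B \<noteq> {}" and k: "k \<ge> 1" "\<And>b c. b \<in> B \<Longrightarrow> c \<in> B \<Longrightarrow> \<delta> (b - c) \<le> k"
    and np: "2 * int n < p" "n > 0"
  shows "\<exists>r\<in>{1..<p}. \<exists>c\<in>B. (\<Sum>b\<in>B. 1 - cos (2 * pi * r * (b - c) / p)) \<le> 2 * real k / real n * real (card B)"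
proof -
  define V where "V r = (\<Sum>c\<in>B. \<Sum>b\<in>B. 1 - cos (2 * pi * real_of_int r * real_of_int (b - c) / p))" for r
  define m where "m = real (card B)"
  have m0: "m > 0" unfolding m_def using B by (simp add: card_gt_0_iff)
  have Cpos: "fourier_weight r \<ge> 0" for r unfolding fourier_weight_def by simp
  have tot: "(\<Sum>r\<in>{0..<p}. fourier_weight r) = p * real n"
    using sum_fourier_weight_mult_cos[of 0] by (simp add: \<delta>_0)
  have one: "(\<Sum>r\<in>{0..<p}. fourier_weight r * (1 - cos (2 * pi * r * x / p))) = p * real (\<delta> x)" for x :: int
    using sum_fourier_weight_mult_cos[of x] tot by (simp add: right_diff_distrib sum_subtractf)
  have "(\<Sum>r\<in>{0..<p}. fourier_weight r * V r)
      = (\<Sum>r\<in>{0..<p}. \<Sum>c\<in>B. \<Sum>b\<in>B. fourier_weight r * (1 - cos (2 * pi * r * real_of_int (b - c) / p)))"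
    unfolding V_def by (simp add: sum_distrib_left)
  also have "\<dots> = (\<Sum>c\<in>B. \<Sum>b\<in>B. \<Sum>r\<in>{0..<p}. fourier_weight r * (1 - cos (2 * pi * r * real_of_int (b - c) / p)))"
    by (subst sum.swap, subst (2) sum.swap, rule refl)
  also have "\<dots> = (\<Sum>c\<in>B. \<Sum>b\<in>B. p * real (\<delta> (b - c)))" by (simp only: one)
  also have "\<dots> \<le> (\<Sum>c\<in>B. \<Sum>b\<in>B. p * real k)"
    using k p_pos by (intro sum_mono mult_left_mono) auto
  also have "\<dots> = p * real k * m * m" unfolding m_def by simp
  finally have upper: "(\<Sum>r\<in>{0..<p}. fourier_weight r * V r) \<le> p * real k * m * m" .
  have split: "{0..<p} = insert 0 {1..<p}" using p_pos by auto
  have C0: "fourier_weight 0 = real n ^ 2" unfolding fourier_weight_def n_def by simp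
  have rest: "(\<Sum>r\<in>{1..<p}. fourier_weight r) = p * real n - real n ^ 2"
    using tot unfolding split by (simp add: C0)
  have "\<exists>r\<in>{1..<p}. V r \<le> 2 * real k / real n * m * m"
  proof (rule ccontr)
    assume "\<not> ?thesis"
    then have V: "2 * real k / real n * m * m \<le> V r" if "r \<in> {1..<p}" for r using that by force
    have "(p * real n - real n ^ 2) * (2 * real k / real n * m * m) = (\<Sum>r\<in>{1..<p}. fourier_weight r * (2 * real k / real n * m * m))"
      unfolding rest[symmetric] by (rule sum_distrib_right)
    also have "\<dots> \<le> (\<Sum>r\<in>{1..<p}. fourier_weight r * V r)"
      using V Cpos by (intro sum_mono mult_left_mono) auto
    also have "\<dots> \<le> (\<Sum>r\<in>{0..<p}. fourier_weight r * V r)"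
      unfolding split by (simp add: V_def)
    finally have "(p * real n - real n ^ 2) * (2 * real k / real n * m * m) \<le> p * real k * m * m" using upper by linarith
    moreover have "(p * real n - real n ^ 2) * (2 * real k / real n * m * m) = (2 * (p - real n)) * (real k * m * m)"
      using np(2) by (simp add: field_simps power2_eq_square)
    ultimately have "(2 * (p - real n)) * (real k * m * m) \<le> p * (real k * m * m)" by (simp add: mult_ac)
    moreover have "real k * m * m > 0" using k m0 by simp
    ultimately have "2 * (p - real n) \<le> p" by (simp only: mult_le_cancel_right_pos)
    moreover have "2 * real n < real_of_int p" using np by linarith
    ultimately show False by simp
  qed
  then obtain r where r: "r \<in> {1..<p}" "V r \<le> 2 * real k / real n * m * m" by blast
  have "\<exists>c\<in>B. (\<Sum>b\<in>B. 1 - cos (2 * pi * r * (b - c) / p)) \<le> 2 * real k / real n * m"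
  proof (rule ccontr)
    assume "\<not> ?thesis"
    then have "(\<Sum>c\<in>B. 2 * real k / real n * m) < (\<Sum>c\<in>B. \<Sum>b\<in>B. 1 - cos (2 * pi * r * (b - c) / p))"
      using B by (intro sum_strict_mono) auto
    then show False using r(2) unfolding V_def m_def by (simp add: mult_ac)
  qed
  then show ?thesis using r(1) unfolding m_def by blast
qed

end

section \<open>Iterated sums of a short set of integers\<close>

lemma ex_generator_of_int_subgroup:
  fixes P :: "int set"
  assumes diff: "\<And>x y. x \<in> P \<Longrightarrow> y \<in> P \<Longrightarrow> x - y \<in> P" and ne: "z \<in> P" "z > 0"
  shows "\<exists>g\<in>P. g > 0 \<and> (\<forall>x\<in>P. g dvd x)"
proof -
  have zero: "0 \<in> P" using diff[OF ne(1) ne(1)] by simp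
  have neg: "- x \<in> P" if "x \<in> P" for x using diff[OF zero that] by simp
  have add: "x + y \<in> P" if "x \<in> P" "y \<in> P" for x y using diff[OF that(1) neg[OF that(2)]] by simp
  have mult: "int i * x \<in> P" if "x \<in> P" for i x
  proof (induction i)
    case (Suc i)
    have "int (Suc i) * x = x + int i * x" by (simp add: distrib_right)
    also have "\<dots> \<in> P" using that Suc by (rule add)
    finally show ?case .
  qed (simp add: zero)
  define i where "i = (LEAST i. i > 0 \<and> int i \<in> P)"
  have "nat z > 0 \<and> int (nat z) \<in> P" using ne by simp
  then have i: "i > 0" "int i \<in> P" unfolding i_def by (metis (mono_tags, lifting) LeastI)+
  have "int i dvd x" if x: "x \<in> P" for x
  proof -
    have "(x div int i) * int i \<in> P"
    proof (cases "x div int i \<ge> 0")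
      case True
      then show ?thesis using mult[OF i(2), of "nat (x div int i)"] by simp
    next
      case False
      then have "(x div int i) * int i = - (int (nat (- (x div int i))) * int i)" by simp
      also have "\<dots> \<in> P" by (rule neg[OF mult[OF i(2)]])
      finally show ?thesis .
    qed
    from diff[OF x this] have "x mod int i \<in> P" by (simp only: minus_div_mult_eq_mod)
    moreover have "x mod int i \<ge> 0" "x mod int i < int i" using i by auto
    ultimately have "\<not> nat (x mod int i) > 0"
      using not_less_Least[of "nat (x mod int i)" "\<lambda>i. i > 0 \<and> int i \<in> P"] unfolding i_def[symmetric] by auto
    then have "x mod int i = 0" using \<open>x mod int i \<ge> 0\<close> by linarith
    then show ?thesis by auto
  qed
  then show ?thesis using i by (intro bexI[of _ "int i"]) auto
qed

primrec iterated_sum :: "int set \<Rightarrow> nat \<Rightarrow> int set" where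
  "iterated_sum D 0 = {0}"
| "iterated_sum D (Suc j) = (\<lambda>(x, d). x + d) ` (iterated_sum D j \<times> D)"

text \<open>Modelled on \<open>D = E - E\<close>. Sizes of iterated sums are compared with the
  numbers of their residues modulo the largest element \<open>L\<close>; the gcd condition keeps
  these residues growing until all are reached.\<close>

locale symmetric_int_set =
  fixes D :: "int set" and L :: int
  assumes finD: "finite D" and zeroD: "0 \<in> D" and symD: "d \<in> D \<Longrightarrow> - d \<in> D"
    and LD: "L \<in> D" and Lpos: "L > 0" and boundD: "d \<in> D \<Longrightarrow> \<bar>d\<bar> \<le> L"
    and gcdD: "\<And>g. (\<And>d. d \<in> D \<Longrightarrow> g dvd d) \<Longrightarrow> g dvd 1"
begin

abbreviation S where "S \<equiv> iterated_sum D"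
definition R :: "nat \<Rightarrow> int set" where "R j = (\<lambda>x. x mod L) ` S j"

lemma S_step: "x \<in> S j \<Longrightarrow> d \<in> D \<Longrightarrow> x + d \<in> S (Suc j)" by force
lemma S_mono_Suc: "S j \<subseteq> S (Suc j)"
proof
  fix x assume "x \<in> S j"
  then show "x \<in> S (Suc j)" using S_step[OF _ zeroD] by simp
qed
lemma finite_S: "finite (S j)" using finD by (induction j) auto
lemma finite_R: "finite (R j)" unfolding R_def using finite_S by simp
lemma S_bound: "x \<in> S j \<Longrightarrow> \<bar>x\<bar> \<le> int j * L"
proof (induction j arbitrary: x)
  case (Suc j)
  then obtain y d where "x = y + d" "y \<in> S j" "d \<in> D" by auto
  moreover have "\<bar>y\<bar> \<le> int j * L" "\<bar>d\<bar> \<le> L" using Suc.IH boundD calculation by auto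
  ultimately show ?case by (simp add: distrib_right)
qed simp
lemma R_mono: "i \<le> j \<Longrightarrow> R i \<subseteq> R j"
  using lift_Suc_mono_le[of S, OF S_mono_Suc] unfolding R_def by blast
lemma R_sub: "R j \<subseteq> {0..<L}" unfolding R_def using Lpos by auto

text \<open>In every residue class modulo \<open>L\<close> that meets \<open>S j\<close>, the
  largest element shifted by \<open>L\<close> is new.\<close>

lemma card_S_Suc: "card (S j) + card (R j) \<le> card (S (Suc j))"
proof -
  define top where "top \<rho> = Max {x \<in> S j. x mod L = \<rho>}" for \<rho>
  have top: "top \<rho> \<in> S j" "top \<rho> mod L = \<rho>" "\<And>x. x \<in> S j \<Longrightarrow> x mod L = \<rho> \<Longrightarrow> x \<le> top \<rho>" if "\<rho> \<in> R j" for \<rho>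
  proof -
    have f: "finite {x \<in> S j. x mod L = \<rho>}" using finite_S by simp
    have "{x \<in> S j. x mod L = \<rho>} \<noteq> {}" using that unfolding R_def by auto
    from Max_in[OF f this] show "top \<rho> \<in> S j" "top \<rho> mod L = \<rho>" unfolding top_def by auto
    show "\<And>x. x \<in> S j \<Longrightarrow> x mod L = \<rho> \<Longrightarrow> x \<le> top \<rho>" unfolding top_def using f by (intro Max_ge) auto
  qed
  let ?f = "\<lambda>\<rho>. top \<rho> + L"
  have "inj_on ?f (R j)" by (rule inj_onI) (metis add_right_cancel top(2))
  then have "card (?f ` R j) = card (R j)" by (rule card_image)
  moreover have "S j \<inter> ?f ` R j = {}"
  proof (rule ccontr)
    assume "S j \<inter> ?f ` R j \<noteq> {}"
    then obtain \<rho> where r: "\<rho> \<in> R j" "top \<rho> + L \<in> S j" by blast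
    have "(top \<rho> + L) mod L = \<rho>" using top(2)[OF r(1)] by simp
    then have "top \<rho> + L \<le> top \<rho>" by (rule top(3)[OF r])
    then show False using Lpos by simp
  qed
  moreover have "S j \<union> ?f ` R j \<subseteq> S (Suc j)" using S_mono_Suc top(1) S_step[OF _ LD] by blast
  then have "card (S j \<union> ?f ` R j) \<le> card (S (Suc j))" by (rule card_mono[OF finite_S])
  ultimately show ?thesis using card_Un_disjoint[of "S j" "?f ` R j"] finite_S finite_R by simp
qed

lemma card_S_ge: "i * card (R j) \<le> card (S (j + i))"
proof (induction i)
  case (Suc i)
  have "card (R j) \<le> card (R (j + i))" by (intro card_mono finite_R R_mono) simp
  then show ?case using Suc card_S_Suc[of "j + i"] by simp
qed simp

text \<open>The stabiliser of the residues reached is a subgroup of the integers containing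
  \<open>D\<close>, hence everything by the gcd condition.\<close>

lemma R_stable_full: assumes "R (Suc j) = R j" shows "R j = {0..<L}"
proof -
  define Z where "Z = {x. x mod L \<in> R j}"
  have Zd: "x + d \<in> Z" if "x \<in> Z" "d \<in> D" for x d
  proof -
    obtain y where y: "y \<in> S j" "x mod L = y mod L" using \<open>x \<in> Z\<close> unfolding Z_def R_def by auto
    have "(x + d) mod L = (y + d) mod L" using y(2) by (metis mod_add_left_eq)
    also have "\<dots> \<in> R (Suc j)" unfolding R_def using S_step[OF y(1) that(2)] by blast
    finally show ?thesis using assms unfolding Z_def by simp
  qed
  define P where "P = {h. \<forall>x\<in>Z. x + h \<in> Z \<and> x - h \<in> Z}"
  have DP: "D \<subseteq> P" unfolding P_def using Zd symD by force
  have subP: "x - y \<in> P" if "x \<in> P" "y \<in> P" for x y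
    unfolding P_def
  proof (intro CollectI ballI)
    fix u assume "u \<in> Z"
    then have "u + x \<in> Z" "u - x \<in> Z" using that unfolding P_def by auto
    then have "(u + x) - y \<in> Z" "(u - x) + y \<in> Z" using that unfolding P_def by blast+
    then show "u + (x - y) \<in> Z \<and> u - (x - y) \<in> Z" by (simp add: algebra_simps)
  qed
  have "L \<in> P" using DP LD by blast
  from ex_generator_of_int_subgroup[OF subP this Lpos]
  obtain g where g: "g \<in> P" "g > 0" "\<forall>x\<in>P. g dvd x" by blast
  then have "g dvd 1" using DP by (intro gcdD) blast
  then have one: "1 \<in> P" using g by simp
  have "0 \<in> S j" using S_mono_Suc by (induction j) auto
  then have "0 \<in> Z" unfolding Z_def R_def by force
  have "x \<in> Z" for x
    by (induction x rule: int_induct[of _ 0]) (use one \<open>0 \<in> Z\<close> in \<open>auto simp: P_def\<close>)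
  have "{0..<L} \<subseteq> R j"
  proof
    fix x assume "x \<in> {0..<L}"
    then show "x \<in> R j" using \<open>x \<in> Z\<close> unfolding Z_def by simp
  qed
  then show ?thesis using R_sub by blast
qed

text \<open>The device of \<open>card_lev_add\<close> again: if \<open>y\<close> is in
  \<open>S (3 * i + 2)\<close> and its residue is new there, then the residues of
  \<open>y + D\<close> avoid \<open>R (3 * i)\<close> by symmetry of \<open>D\<close>, and all of
  them appear one step later.\<close>

lemma card_R_ge:
  assumes "R (3 * i) \<noteq> {0..<L}"
  shows "i * card (R 1) \<le> card (R (3 * i))"
  using assms
proof (induction i)
  case (Suc i)
  have full_mono: "R l = {0..<L}" if "R j = {0..<L}" "j \<le> l" for j l
    using R_mono[OF that(2)] R_sub[of l] that(1) by blast
  have "R (3 * i) \<noteq> {0..<L}" using full_mono[of "3 * i" "3 * Suc i"] Suc.prems by auto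
  then have IH: "i * card (R 1) \<le> card (R (3 * i))" by (rule Suc.IH)
  have "R (Suc (3 * i + 1)) \<noteq> R (3 * i + 1)"
    using R_stable_full[of "3 * i + 1"] full_mono[of "3 * i + 1" "3 * Suc i"] Suc.prems by auto
  moreover have "R (3 * i + 1) \<subseteq> R (Suc (3 * i + 1))" by (rule R_mono) simp
  ultimately obtain \<rho> where "\<rho> \<in> R (Suc (3 * i + 1))" "\<rho> \<notin> R (3 * i + 1)" by blast
  then obtain y where y: "y \<in> S (Suc (3 * i + 1))" "y mod L \<notin> R (3 * i + 1)" unfolding R_def by blast
  define T where "T = (\<lambda>d. (y + d) mod L) ` D"
  have R1: "R 1 = (\<lambda>d. d mod L) ` D" unfolding R_def by force
  have "card T = card (R 1)"
  proof -
    have "bij_betw (\<lambda>r. (y + r) mod L) (R 1) T"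
    proof -
      have "inj_on (\<lambda>r. (y + r) mod L) (R 1)"
      proof (rule inj_onI)
        fix r r' assume r: "r \<in> R 1" "r' \<in> R 1" "(y + r) mod L = (y + r') mod L"
        then have "r mod L = r' mod L" by (simp add: mod_eq_dvd_iff)
        then show "r = r'" using r(1,2) R_sub[of 1] by (simp add: subset_iff)
      qed
      moreover have "(\<lambda>r. (y + r) mod L) ` R 1 = T"
        unfolding R1 T_def image_image by (simp add: mod_add_right_eq)
      ultimately show ?thesis unfolding bij_betw_def by blast
    qed
    then show ?thesis by (rule bij_betw_same_card[symmetric])
  qed
  moreover have "T \<inter> R (3 * i) = {}"
  proof (rule ccontr)
    assume "T \<inter> R (3 * i) \<noteq> {}"
    then obtain d x where dx: "d \<in> D" "x \<in> S (3 * i)" "(y + d) mod L = x mod L"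
      unfolding T_def R_def by auto
    then have "y mod L = (x + - d) mod L" by (simp add: mod_eq_dvd_iff algebra_simps)
    moreover have "x + - d \<in> S (3 * i + 1)" using S_step[OF dx(2) symD[OF dx(1)]] by simp
    ultimately show False using y(2) unfolding R_def by blast
  qed
  moreover have "T \<union> R (3 * i) \<subseteq> R (3 * Suc i)"
  proof -
    have "y + d \<in> S (3 * Suc i)" if "d \<in> D" for d using S_step[OF y(1) that] by (simp add: numeral_3_eq_3)
    then show ?thesis using R_mono[of "3 * i" "3 * Suc i"] unfolding T_def R_def by auto
  qed
  then have "card (T \<union> R (3 * i)) \<le> card (R (3 * Suc i))" by (rule card_mono[OF finite_R])
  moreover have "finite T" unfolding T_def using finD by simp
  ultimately show ?case using card_Un_disjoint[of T "R (3 * i)"] finite_R IH by simp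
qed simp

end

context cyclic_set
begin

text \<open>Once \<open>R 291\<close> is full, every \<open>x\<close> is \<open>y + q * L\<close>
  with \<open>y \<in> S 291\<close>, which yields slope \<open>k / L\<close> up to an error
  \<open>O(k)\<close>. Fullness comes from playing the linear bound on level sets against the growth
  of iterated sums.\<close>

lemma \<delta>_le_of_short_generators:
  assumes E: "finite E" "0 \<in> E" and k: "k \<ge> 1" "\<And>x y. x \<in> E \<Longrightarrow> y \<in> E \<Longrightarrow> \<delta> (x - y) \<le> k"
    and big: "k + 2 \<le> 2 * card E"
    and small: "\<And>x. x \<in> E \<Longrightarrow> 2400 * \<bar>x\<bar> \<le> p"
    and gcdE: "\<And>g. (\<And>x. x \<in> E \<Longrightarrow> g dvd x) \<Longrightarrow> g dvd 1"
    and n: "3492 * k \<le> n" and np: "2 * int n < p"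
  defines "L \<equiv> Max E - Min E"
  shows "L * int (\<delta> x) \<le> int k * (\<bar>x\<bar> + 582 * L)"
proof -
  define D where "D = (\<lambda>(x, y). x - y) ` (E \<times> E)"
  have neE: "E \<noteq> {}" using E by auto
  have bnd: "Min E \<le> e" "e \<le> Max E" if "e \<in> E" for e using E that by auto
  have mm: "Max E \<in> E" "Min E \<in> E" using E neE by auto
  have "\<not> E \<subseteq> {Min E}"
  proof
    assume "E \<subseteq> {Min E}"
    then have "card E \<le> card {Min E}" by (intro card_mono) auto
    then show False using big k by simp
  qed
  then obtain e where "e \<in> E" "e \<noteq> Min E" by blast
  then have L0: "L > 0" unfolding L_def using bnd[of e] by linarith
  interpret symmetric_int_set D L
  proof
    show "finite D" unfolding D_def using E by auto
    show "0 \<in> D" unfolding D_def using E by force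
    show "- d \<in> D" if "d \<in> D" for d using that unfolding D_def by force
    show "L \<in> D" unfolding D_def L_def using mm by force
    show "L > 0" by (rule L0)
    show "\<bar>d\<bar> \<le> L" if dD: "d \<in> D" for d
    proof -
      obtain u v where "d = u - v" "u \<in> E" "v \<in> E" using dD unfolding D_def by auto
      then show ?thesis using bnd[of u] bnd[of v] unfolding L_def by linarith
    qed
    show "g dvd 1" if g: "\<And>d. d \<in> D \<Longrightarrow> g dvd d" for g
    proof (rule gcdE)
      fix u assume "u \<in> E"
      then have "u - 0 \<in> D" unfolding D_def using E(2) by (intro image_eqI[of _ _ "(u, 0)"]) auto
      then show "g dvd u" using g by simp
    qed
  qed
  have Lp: "1200 * L \<le> p" using small[OF mm(1)] small[OF mm(2)] unfolding L_def right_diff_distrib by linarith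
  have \<delta>D: "\<delta> d \<le> k" if "d \<in> D" for d using that k(2) unfolding D_def by auto
  have \<delta>S: "x \<in> S j \<Longrightarrow> \<delta> x \<le> j * k" for x j
  proof (induction j arbitrary: x)
    case (Suc j)
    then obtain y d where y: "x = y + d" "y \<in> S j" "d \<in> D" by auto
    then show ?case using Suc.IH[OF y(2)] \<delta>D[OF y(3)] \<delta>_add[of y d] by simp
  qed (simp add: \<delta>_0)
  \<comment> \<open>\<open>\<delta>\<close> is at most \<open>582 * k\<close> on this set, which
    embeds in the residues because \<open>2 * 582 * L < 1200 * L \<le> p\<close>. The factor in the
    hypothesis on \<open>n\<close> is \<open>3492 = 6 * 582\<close>.\<close>
  have cardS: "card (S (291 + 291)) \<le> 24 * (582 * k)"
  proof (rule card_le_linear)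
    show "inj_on (\<lambda>x. x mod p) (S (291 + 291))"
    proof (rule inj_onI)
      fix u v assume uv: "u \<in> S (291 + 291)" "v \<in> S (291 + 291)" "u mod p = v mod p"
      then have "\<bar>u - v\<bar> < p" using S_bound[OF uv(1)] S_bound[OF uv(2)] Lp L0 by simp
      moreover have "p dvd u - v" using uv(3) by (simp add: mod_eq_dvd_iff)
      ultimately show "u = v" using zdvd_imp_le[of p "\<bar>u - v\<bar>"] by force
    qed
    show "\<delta> x \<le> 582 * k" if "x \<in> S (291 + 291)" for x using \<delta>S[OF that] by simp
  qed (use k n np in auto)
  then have cR: "card (R 291) \<le> 48 * k" using card_S_ge[of 291 291] by linarith
  have full: "R 291 = {0..<L}"
  proof (rule ccontr)
    assume "R 291 \<noteq> {0..<L}"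
    \<comment> \<open>Since \<open>card (R 1) \<ge> k / 2\<close>, the left side is at least
      \<open>48.5 * k\<close>. The number \<open>97\<close>, with \<open>291 = 3 * 97\<close>, is
      chosen to exceed twice the factor \<open>48 = 24 * 582 / 291\<close>.\<close>
    then have "97 * card (R 1) \<le> 48 * k" using card_R_ge[of 97] cR by simp
    moreover have "card E - 1 \<le> card (R 1)"
    proof -
      have "card (E - {Max E}) \<le> card (R 1)"
      proof (rule card_inj_on_le[of "\<lambda>e. e - Min E"])
        show "(\<lambda>e. e - Min E) ` (E - {Max E}) \<subseteq> R 1"
        proof (rule image_subsetI)
          fix e assume e: "e \<in> E - {Max E}"
          then have "e - Min E \<in> D" unfolding D_def using mm by force
          then have "e - Min E \<in> S 1" by force
          moreover have "(e - Min E) mod L = e - Min E" using e bnd[of e] unfolding L_def by auto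
          ultimately show "e - Min E \<in> R 1" unfolding R_def by (metis imageI)
        qed
      qed (auto simp: finite_R inj_on_def)
      then show ?thesis using E mm by simp
    qed
    ultimately show False using big k by linarith
  qed
  have "x mod L \<in> R 291" unfolding full using L0 by simp
  then obtain y where y: "y \<in> S 291" "x mod L = y mod L" unfolding R_def by auto
  then obtain q where q: "x - y = L * q" by (metis dvd_def mod_eq_dvd_iff)
  have "\<delta> L \<le> k" using \<delta>D LD by blast
  then have "\<delta> (q * L) \<le> nat \<bar>q\<bar> * k" using \<delta>_mult[of q L] by (meson mult_le_mono2 order_trans)
  moreover have "x = y + q * L" using q by (simp add: algebra_simps)
  ultimately have "\<delta> x \<le> 291 * k + nat \<bar>q\<bar> * k" using \<delta>_add[of y "q * L"] \<delta>S[OF y(1)] by simp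
  then have "int (\<delta> x) \<le> int (291 * k + nat \<bar>q\<bar> * k)" by (rule of_nat_mono)
  also have "\<dots> = int k * (291 + \<bar>q\<bar>)" by (simp add: algebra_simps)
  finally have "int (\<delta> x) \<le> int k * (291 + \<bar>q\<bar>)" .
  then have "L * int (\<delta> x) \<le> L * (int k * (291 + \<bar>q\<bar>))" using L0 by (intro mult_left_mono) auto
  also have "\<dots> = int k * (291 * L + \<bar>L * q\<bar>)" using L0 by (simp add: algebra_simps abs_mult)
  also have "\<dots> \<le> int k * (\<bar>x\<bar> + 582 * L)"
  proof (intro mult_left_mono)
    show "291 * L + \<bar>L * q\<bar> \<le> \<bar>x\<bar> + 582 * L" using q[symmetric] S_bound[OF y(1)] by simp
  qed simp
  finally show ?thesis .
qed

end

section \<open>Tents\<close>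

lemma sum_abs_int_interval:
  "2 * (\<Sum>y\<in>{- int u..int v}. real_of_int \<bar>y\<bar>) = real u * (real u + 1) + real v * (real v + 1)"
proof (induction u)
  case 0
  show ?case
  proof (induction v)
    case (Suc v)
    have "{- int 0..int (Suc v)} = insert (int (Suc v)) {- int 0..int v}" by auto
    then show ?case using Suc by (simp add: algebra_simps)
  qed simp
next
  case (Suc u)
  have "{- int (Suc u)..int v} = insert (- int (Suc u)) {- int u..int v}" by auto
  then show ?case using Suc by (simp add: algebra_simps)
qed

context cyclic_set
begin

lemma sum_tent_ge:
  assumes "\<And>y. real (\<delta> (x + y)) \<le> \<kappa> * real_of_int \<bar>y\<bar> + c"
  shows "(\<Sum>y\<in>{x - int u..x + int v}. real n - real (\<delta> y))
    \<ge> (real u + real v + 1) * (real n - c) - \<kappa> / 2 * (real u * (real u + 1) + real v * (real v + 1))"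
proof -
  have "(\<Sum>y\<in>{- int u..int v}. real n - c - \<kappa> * real_of_int \<bar>y\<bar>)
      \<le> (\<Sum>y\<in>{- int u..int v}. real n - real (\<delta> (x + y)))"
    using assms by (intro sum_mono) (simp add: algebra_simps)
  also have "\<dots> = (\<Sum>y\<in>{x - int u..x + int v}. real n - real (\<delta> y))"
    by (rule sum.reindex_bij_witness[of _ "\<lambda>y. y - x" "\<lambda>y. x + y"]) auto
  also have "(\<Sum>y\<in>{- int u..int v}. real n - c - \<kappa> * real_of_int \<bar>y\<bar>)
      = (real u + real v + 1) * (real n - c) - \<kappa> / 2 * (2 * (\<Sum>y\<in>{- int u..int v}. real_of_int \<bar>y\<bar>))"
    unfolding sum_subtractf sum_distrib_left[symmetric] by (simp add: algebra_simps)
  finally show ?thesis unfolding sum_abs_int_interval .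
qed

lemma inj_mod_interval: "v - u < p \<Longrightarrow> inj_on (\<lambda>x. x mod p) {u..v}"
proof (rule inj_onI)
  fix x y assume uv: "v - u < p" and xy: "x \<in> {u..v}" "y \<in> {u..v}" "x mod p = y mod p"
  have "\<bar>x - y\<bar> < p" using uv xy by auto
  moreover have "p dvd x - y" using xy(3) by (simp add: mod_eq_dvd_iff)
  ultimately show "x = y" using zdvd_imp_le[of p "\<bar>x - y\<bar>"] by force
qed

text \<open>The tents \<open>y \<mapsto> n - \<kappa>\<bar>y\<bar>\<close> centred at \<open>0\<close> and at \<open>x\<close> bound the number of
  representations from below; if \<open>x\<close> were far from \<open>0\<close>, their union would have more than
  \<open>n\<^sup>2\<close> area.\<close>
lemma outlier_bound:
  assumes tent: "\<And>y. real (\<delta> y) \<le> \<kappa> * real_of_int \<bar>y\<bar> + c"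
    and x: "0 < x" "2 * x \<le> p" "real (\<delta> x) \<le> c"
    and \<kappa>: "\<kappa> \<ge> 0" "(\<kappa> - 1) * real n \<le> e" "e \<ge> 0" and n: "n \<ge> 2" "2 * int n < p"
    and big: "16 * c + 4 * e + 2 < real n" and c: "c \<ge> 0"
  shows "real_of_int x \<le> 16 * c + 4 * e + 2"
proof -
  \<comment> \<open>Each interval extends \<open>h\<close>, just under half of \<open>w\<close>,
    towards the other centre and \<open>u\<close> away from it. The two are then disjoint, and each
    has \<open>u + h + 1 = n\<close> points.\<close>
  define w where "w = min x (int n)"
  define h where "h = nat ((w - 1) div 2)"
  have h: "2 * int h < w" "w \<le> 2 * int h + 2" unfolding h_def w_def using x n by auto
  have hn: "2 * h < n" "2 * int h < x" using h unfolding w_def by auto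
  define u where "u = n - 1 - h"
  have u: "real u = real n - 1 - real h" unfolding u_def using hn by (simp add: of_nat_diff)
  let ?X1 = "{0 - int u..0 + int h}" and ?X2 = "{x - int h..x + int u}"
  have dis: "?X1 \<inter> ?X2 = {}" using hn by auto
  have sub: "?X1 \<union> ?X2 \<subseteq> {- int u..x + int u}" using hn by auto
  have "x + int u - (- int u) < p"
  proof (cases "x \<le> int n")
    case True
    then have "x \<le> 2 * int h + 2" using h unfolding w_def by simp
    then show ?thesis unfolding u_def using hn n by auto
  next
    case False
    then have "int n \<le> 2 * int h + 2" using h unfolding w_def by simp
    then show ?thesis unfolding u_def using hn n x by auto
  qed
  then have inj: "inj_on (\<lambda>x. x mod p) (?X1 \<union> ?X2)" using inj_mod_interval sub by (blast intro: inj_on_subset)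
  have tent2: "real (\<delta> (x + y)) \<le> \<kappa> * real_of_int \<bar>y\<bar> + 2 * c" for y
    using tent[of y] x(3) \<delta>_add[of x y] by linarith
  have tent1: "real (\<delta> (0 + y)) \<le> \<kappa> * real_of_int \<bar>y\<bar> + 2 * c" for y
    using tent[of y] c by simp
  have "(\<Sum>y\<in>?X1 \<union> ?X2. real n - real (\<delta> y)) = (\<Sum>y\<in>?X1. real n - real (\<delta> y)) + (\<Sum>y\<in>?X2. real n - real (\<delta> y))"
    by (rule sum.union_disjoint[OF _ _ dis]) auto
  then have "(\<Sum>y\<in>?X1. real n - real (\<delta> y)) + (\<Sum>y\<in>?X2. real n - real (\<delta> y)) \<le> real n ^ 2"
    using sum_return_le[OF _ inj] by simp
  then have "2 * ((real u + real h + 1) * (real n - 2 * c)) - \<kappa> * (real u * (real u + 1) + real h * (real h + 1)) \<le> real n ^ 2"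
    using sum_tent_ge[OF tent1, of u h] sum_tent_ge[OF tent2, of h u] by (simp add: algebra_simps)
  moreover have "real u + real h + 1 = real n" using u by simp
  ultimately have main: "2 * (real n * (real n - 2 * c)) \<le> real n ^ 2 + \<kappa> * (real u * (real u + 1) + real h * (real h + 1))"
    by simp
  define q where "q = real u * (real u + 1) + real h * (real h + 1)"
  \<comment> \<open>At unit slope the two tents together lose area \<open>q\<close>; the saving of
    \<open>(n - 1) * h\<close> against \<open>n ^ 2\<close> is what bounds \<open>h\<close>.\<close>
  have q: "q \<le> real n ^ 2 - (real n - 1) * real h"
  proof -
    have "q = (real n - 1 - real h) * (real n - real h) + real h * (real h + 1)" unfolding q_def u by simp
    also have "\<dots> = real n ^ 2 - 2 * (real n * real h) + 2 * (real h * real h) - real n + 2 * real h"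
      by (simp add: algebra_simps power2_eq_square)
    also have "2 * (real h * real h) \<le> real n * real h"
      using mult_right_mono[of "2 * real h" "real n" "real h"] hn by simp
    also have "real n ^ 2 - 2 * (real n * real h) + real n * real h - real n + 2 * real h \<le> real n ^ 2 - (real n - 1) * real h"
      using hn by (simp add: algebra_simps)
    finally show ?thesis by simp
  qed
  have q0: "q \<ge> 0" unfolding q_def by simp
  have qn: "q \<le> real n * real n" using q n by (simp add: power2_eq_square mult_nonneg_nonneg order_trans[OF q])
  have "\<kappa> * q = q + (\<kappa> - 1) * q" by (simp add: algebra_simps)
  also have "(\<kappa> - 1) * q \<le> e * real n"
  proof (cases "\<kappa> \<ge> 1")
    case True
    then have "(\<kappa> - 1) * q \<le> (\<kappa> - 1) * (real n * real n)" using qn by (intro mult_left_mono) auto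
    also have "\<dots> \<le> e * real n" using mult_right_mono[OF \<kappa>(2), of "real n"] by (simp add: mult_ac)
    finally show ?thesis .
  next
    case False
    then have "(\<kappa> - 1) * q \<le> 0" using q0 by (intro mult_nonpos_nonneg) auto
    moreover have "e * real n \<ge> 0" using \<kappa> by simp
    ultimately show ?thesis by linarith
  qed
  finally have "2 * (real n * real n) - 4 * (c * real n) \<le> 2 * (real n * real n) - (real n - 1) * real h + e * real n"
    using main q unfolding q_def[symmetric] by (simp add: algebra_simps power2_eq_square)
  then have "(real n - 1) * real h \<le> (4 * c + e) * real n" by (simp add: algebra_simps)
  moreover have "real n / 2 * real h \<le> (real n - 1) * real h" using n by (intro mult_right_mono) auto
  ultimately have "real n * real h \<le> real n * (8 * c + 2 * e)" by (simp add: algebra_simps)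
  then have hb: "real h \<le> 8 * c + 2 * e" using n by simp
  have "real_of_int w \<le> 2 * real h + 2" using h(2) by linarith
  \<comment> \<open>With \<open>x \<ge> n\<close> one would have \<open>w = n\<close>, against
    \<open>big\<close>; so the bound on \<open>h\<close> concerns \<open>x\<close> itself.\<close>
  then have "w < int n" using hb big by linarith
  then have "w = x" unfolding w_def by simp
  then have "real_of_int x \<le> 2 * real h + 2" using h(2) by linarith
  then show ?thesis using hb by linarith
qed

text \<open>Up to lower order terms, a tent at \<open>0\<close> over \<open>2 * n - 1\<close> points
  has area \<open>n ^ 2 * (2 - \<kappa>)\<close>, which \<open>sum_return_le\<close> bounds by
  \<open>n ^ 2\<close>.\<close>

lemma slope_ge:
  assumes tent: "\<And>y. real (\<delta> y) \<le> \<kappa> * real_of_int \<bar>y\<bar> + c"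
    and n: "n \<ge> 1" "2 * int n < p" and c: "c \<ge> 0" "\<kappa> \<ge> 0"
  shows "real n * (1 - \<kappa>) \<le> 1 + 2 * c"
proof -
  define u where "u = n - 1"
  have u: "real u = real n - 1" unfolding u_def using n by (simp add: of_nat_diff)
  have "inj_on (\<lambda>x. x mod p) {0 - int u..0 + int u}"
    by (rule inj_mod_interval) (use n in \<open>auto simp: u_def\<close>)
  then have "(\<Sum>y\<in>{0 - int u..0 + int u}. real n - real (\<delta> y)) \<le> real n ^ 2"
    by (intro sum_return_le) auto
  moreover have "real (\<delta> (0 + y)) \<le> \<kappa> * real_of_int \<bar>y\<bar> + c" for y using tent by simp
  note sum_tent_ge[OF this, of u u]
  ultimately have "(2 * real u + 1) * (real n - c) - \<kappa> * (real u * (real u + 1)) \<le> real n ^ 2"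
    by (simp add: algebra_simps)
  then have "real n * (real n * (1 - \<kappa>)) \<le> real n * (1 + 2 * c) - c - \<kappa> * real n"
    unfolding u by (simp add: algebra_simps power2_eq_square)
  also have "\<dots> \<le> real n * (1 + 2 * c)"
  proof -
    have "\<kappa> * real n \<ge> 0" using c by simp
    then show ?thesis using c by linarith
  qed
  finally show ?thesis using n by simp
qed

end

section \<open>From residues to integers\<close>

context cyclic_set
begin

text \<open>A representative of least absolute value modulo \<open>p\<close>.\<close>

definition centred :: "int \<Rightarrow> int" where
  "centred x = (x + (p - 1) div 2) mod p - (p - 1) div 2"

lemma centred_mod: "centred x mod p = x mod p"
  unfolding centred_def by (simp add: mod_diff_left_eq)

lemma centred_abs: "2 * \<bar>centred x\<bar> \<le> p"
proof -
  define h where "h = (p - 1) div 2"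
  have "0 \<le> (x + h) mod p" "(x + h) mod p < p" using p_pos by auto
  moreover have "2 * h \<le> p - 1" "p \<le> 2 * h + 2" unfolding h_def by auto
  ultimately show ?thesis unfolding centred_def h_def[symmetric] by (simp add: abs_if)
qed

text \<open>Otherwise, going back from any nonmember reaches \<open>A\<close> within
  \<open>l\<close> steps, at an element that exits under shift \<open>1\<close>. This accounts for
  at most \<open>\<delta> 1 * l\<close> nonmembers, but there are \<open>p - n\<close>.\<close>

lemma ex_gap:
  assumes l: "l \<ge> 1" and few: "int (\<delta> 1) * l < p - int n"
  shows "\<exists>u. \<forall>i\<in>{1..l}. (u + i) mod p \<notin> A"
proof (rule ccontr)
  assume "\<not> ?thesis"
  then have hit: "\<exists>i\<in>{1..l}. (u + i) mod p \<in> A" for u by blast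
  let ?X = "{a \<in> A. (a + 1) mod p \<notin> A}"
  have "{0..<p} - A \<subseteq> (\<lambda>(a, j). (a + j) mod p) ` (?X \<times> {1..l})"
  proof
    fix h assume h: "h \<in> {0..<p} - A"
    obtain i where i: "i \<in> {1..l}" "(h - l - 1 + i) mod p \<in> A" using hit[of "h - l - 1"] by (auto simp: algebra_simps)
    define P where "P j \<longleftrightarrow> (h - int j) mod p \<in> A" for j
    define j where "j = (LEAST j. P j)"
    have "h - int (nat (l + 1 - i)) = h - l - 1 + i" using i by auto
    then have Pi: "P (nat (l + 1 - i))" unfolding P_def using i by (simp only:)
    then have Pj: "P j" unfolding j_def by (rule LeastI)
    have jl: "j \<le> nat (l + 1 - i)" unfolding j_def using Pi by (rule Least_le)
    have "h mod p = h" using h by simp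
    then have "\<not> P 0" unfolding P_def using h by simp
    then have j0: "j \<noteq> 0" using Pj by (metis)
    then have "\<not> P (j - 1)" using not_less_Least[of "j - 1" P] unfolding j_def[symmetric] by simp
    moreover have "h - int j + 1 = h - int (j - 1)" using j0 by (simp add: of_nat_diff)
    then have "((h - int j) mod p + 1) mod p = (h - int (j - 1)) mod p" by (simp only: mod_add_left_eq)
    ultimately have "(h - int j) mod p \<in> ?X" using Pj unfolding P_def by simp
    moreover have "((h - int j) mod p + int j) mod p = h" using \<open>h mod p = h\<close> by (simp add: mod_add_left_eq)
    moreover have "int j \<in> {1..l}" using j0 jl i by auto
    ultimately show "h \<in> (\<lambda>(a, j). (a + j) mod p) ` (?X \<times> {1..l})"
      by (intro image_eqI[of _ _ "((h - int j) mod p, int j)"]) auto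
  qed
  then have "card ({0..<p} - A) \<le> card (?X \<times> {1..l})"
    using finA by (intro surj_card_le) auto
  also have "\<dots> = \<delta> 1 * nat l" unfolding \<delta>_def by (simp add: card_cartesian_product)
  finally have "card ({0..<p} - A) \<le> \<delta> 1 * nat l" .
  moreover have "card ({0..<p} - A) = nat p - n"
    using card_Diff_subset[OF finA A] unfolding n_def by simp
  moreover have "n \<le> nat p" unfolding n_def using card_mono[OF _ A] by simp
  ultimately have "int (nat p - n) \<le> int (\<delta> 1 * nat l)" by linarith
  then show False using few l \<open>n \<le> nat p\<close> p_pos by (simp add: of_nat_diff)
qed

text \<open>The circle is cut at \<open>u\<close>, just before the gap, so a shift by
  \<open>d \<le> l\<close> across the cut lands in the gap and is an exit in the circle as
  well.\<close>

lemma unroll_at_gap: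
  assumes gap: "\<forall>i\<in>{1..l}. (u + i) mod p \<notin> A" and l: "l < p"
  shows "\<exists>A'. finite A' \<and> card A' = n \<and> (\<forall>d\<in>{1..l}. exits A' d \<le> \<delta> d)"
proof -
  define A' where "A' = {x \<in> {u+1..u+p}. x mod p \<in> A}"
  have inj: "inj_on (\<lambda>x. x mod p) A'"
    by (rule inj_on_subset[OF inj_mod_interval[of "u + p" "u + 1"]]) (auto simp: A'_def)
  have "(\<lambda>x. x mod p) ` A' = A"
  proof
    show "A \<subseteq> (\<lambda>x. x mod p) ` A'"
    proof
      fix a assume a: "a \<in> A"
      define x where "x = u + 1 + (a - u - 1) mod p"
      have "x mod p = (u + 1 + (a - u - 1)) mod p" unfolding x_def by (simp only: mod_add_right_eq)
      then have xa: "x mod p = a" using mod_A[OF a] by simp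
      have "0 \<le> (a - u - 1) mod p" "(a - u - 1) mod p < p" using p_pos by auto
      then have "x \<in> {u+1..u+p}" unfolding x_def by auto
      then show "a \<in> (\<lambda>x. x mod p) ` A'" unfolding A'_def using xa a by force
    qed
  qed (auto simp: A'_def)
  then have "card A' = n" unfolding n_def using card_image[OF inj] by simp
  moreover have "exits A' d \<le> \<delta> d" if d: "d \<in> {1..l}" for d
    unfolding exits_def \<delta>_def
  proof (rule card_inj_on_le[of "\<lambda>x. x mod p"])
    show "inj_on (\<lambda>x. x mod p) {x \<in> A'. x + d \<notin> A'}" by (rule inj_on_subset[OF inj]) auto
    show "(\<lambda>x. x mod p) ` {x \<in> A'. x + d \<notin> A'} \<subseteq> {a \<in> A. (a + d) mod p \<notin> A}"
    proof (rule image_subsetI)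
      fix x assume x: "x \<in> {x \<in> A'. x + d \<notin> A'}"
      have "(x + d) mod p \<notin> A"
      proof (cases "x + d \<le> u + p")
        case True
        then show ?thesis using x d unfolding A'_def by auto
      next
        case False
        then have "(u + (x + d - u - p)) mod p \<notin> A" using x d by (intro gap[rule_format]) (auto simp: A'_def)
        moreover have "u + (x + d - u - p) = x + d - p" by simp
        ultimately show ?thesis by simp
      qed
      then show "x mod p \<in> {a \<in> A. (a + d) mod p \<notin> A}" using x unfolding A'_def by (simp add: mod_add_left_eq)
    qed
  qed (use finA in auto)
  moreover have "finite A'" unfolding A'_def by (rule finite_subset[of _ "{u+1..u+p}"]) auto
  ultimately show ?thesis by blast
qed

text \<open>The \<open>k + 1\<close> differences from \<open>Min E\<close> lie in
  \<open>{1..L}\<close> with \<open>L \<le> 1.01 k\<close>, so two are consecutive and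
  \<open>\<delta> 1 \<le> 2 * k\<close>. As \<open>p > 8 * k ^ 2\<close>, there is a gap of length
  \<open>L\<close>, and \<open>card_le_of_few_exits\<close> applies to the unrolled set.\<close>

lemma card_le_of_short_differences:
  assumes E: "finite E" "card E = k + 2" and k: "k \<ge> 1" "\<And>x y. x \<in> E \<Longrightarrow> y \<in> E \<Longrightarrow> \<delta> (x - y) \<le> k"
    and L: "real_of_int (Max E - Min E) \<le> 101 / 100 * real k"
    and p: "8 * (int k + 2)\<^sup>2 < p" "2 * int n < p"
  shows "real n \<le> 50 * real k * (1 + ln (real k))"
proof -
  define L where "L = Max E - Min E"
  have neE: "E \<noteq> {}" using E by auto
  have bnd: "Min E \<le> e" "e \<le> Max E" if "e \<in> E" for e using E that by auto
  have mm: "Max E \<in> E" "Min E \<in> E" using E neE by auto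
  define D where "D = (\<lambda>e. e - Min E) ` (E - {Min E})"
  have cD: "card D = k + 1"
    unfolding D_def using E mm by (subst card_image) (auto simp: inj_on_def)
  have D1: "D \<subseteq> {1..L}"
  proof
    fix d assume "d \<in> D"
    then obtain e where "e \<in> E" "e \<noteq> Min E" "d = e - Min E" unfolding D_def by auto
    then show "d \<in> {1..L}" using bnd[of e] unfolding L_def by auto
  qed
  have "int (card D) \<le> int (card {1..L})" using D1 by (intro of_nat_mono card_mono) auto
  then have Lk: "int k + 1 \<le> L" using cD by (auto split: if_splits)
  then have LD: "L \<in> D" unfolding D_def L_def using mm by auto
  have \<delta>D: "\<delta> d \<le> k" if "d \<in> D" for d using that k(2) mm unfolding D_def by auto
  have "\<exists>d. d \<in> D \<and> d + 1 \<in> D"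
  proof (rule ccontr)
    assume "\<not> ?thesis"
    then have dis: "D \<inter> (\<lambda>d. d + 1) ` D = {}" by auto
    have finD: "finite D" using D1 finite_subset by blast
    have "card (D \<union> (\<lambda>d. d + 1) ` D) = card D + card ((\<lambda>d. d + 1) ` D)"
      using finD by (intro card_Un_disjoint dis) auto
    also have "card ((\<lambda>d. d + 1) ` D) = card D" by (intro card_image) auto
    finally have "2 * card D = card (D \<union> (\<lambda>d. d + 1) ` D)" by simp
    also have "\<dots> \<le> card {1..L + 1}" using D1 by (intro card_mono) auto
    finally have "2 * int k + 2 \<le> L + 1" using cD Lk by auto
    then show False using L k(1) unfolding L_def[symmetric] by linarith
  qed
  then obtain d where "d \<in> D" "d + 1 \<in> D" by blast
  then have one: "\<delta> 1 \<le> 2 * k" using \<delta>_diff[of "d + 1" d] \<delta>D[of d] \<delta>D[of "d + 1"] by simp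
  have L2k: "L \<le> 2 * int k" using L unfolding L_def[symmetric] by linarith
  have sq: "4 * (int k * int k) \<le> 4 * (int k + 2)\<^sup>2" by (simp add: power2_eq_square algebra_simps)
  have "int (\<delta> 1) * L \<le> (2 * int k) * (2 * int k)" using one L2k Lk by (intro mult_mono) auto
  also have "\<dots> < p - int n" using sq p by simp
  finally have gap: "int (\<delta> 1) * L < p - int n" .
  have "2 * int k \<le> 8 * (int k + 2)\<^sup>2" by (simp add: power2_eq_square algebra_simps)
  then have "L < p" using L2k p by linarith
  obtain u where "\<forall>i\<in>{1..L}. (u + i) mod p \<notin> A" using ex_gap[OF _ gap] Lk by auto
  then obtain A' where A': "finite A'" "card A' = n" "\<forall>d\<in>{1..L}. exits A' d \<le> \<delta> d"
    using unroll_at_gap \<open>L < p\<close> by blast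
  have "exits A' d \<le> k" if "d \<in> D" for d using A'(3) \<delta>D[OF that] D1 that by (meson order_trans subsetD)
  then show ?thesis
    using card_le_of_few_exits[OF A'(1) D1 LD, of k] cD L A'(2) unfolding L_def by simp
qed

text \<open>There are two rounds. The short part \<open>E\<close> gives a tent of slope at most
  about \<open>1\<close>, and \<open>outlier_bound\<close> then puts all of \<open>B\<close>, once
  centred, within \<open>O(k)\<close> of \<open>0\<close>. Next, the width \<open>L1\<close> of this
  full set gives a tent of slope \<open>k / L1\<close>, which \<open>slope_ge\<close> shows to be at
  least \<open>100 / 101\<close>.\<close>

lemma card_le_of_mostly_short:
  fixes C0 :: real
  assumes B: "finite B" "inj_on (\<lambda>x. x mod p) B" "card B = k + 2" "0 \<in> B"
    and k: "k \<ge> 1" "\<And>b c. b \<in> B \<Longrightarrow> c \<in> B \<Longrightarrow> \<delta> (b - c) \<le> k"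
    and E: "finite E" "0 \<in> E" "\<And>x. x \<in> E \<Longrightarrow> \<exists>b\<in>B. x mod p = b mod p" "\<And>x. x \<in> E \<Longrightarrow> 2400 * \<bar>x\<bar> \<le> p"
    and gcdE: "\<And>g. (\<And>x. x \<in> E \<Longrightarrow> g dvd x) \<Longrightarrow> g dvd 1"
    and C0: "C0 \<ge> 1" and cE: "real (card E) \<ge> (1 - C0 * real k / real n) * (real k + 2)"
    and p: "8 * (int k + 2)\<^sup>2 < p" "2 * int n < p"
    and R: "real n \<ge> 10000000 * C0 * real k"
  shows "real n \<le> 50 * real k * (1 + ln (real k))"
proof -
  have C0k: "real k \<le> C0 * real k" using C0 mult_right_mono[of 1 C0 "real k"] by simp
  have n0: "real n > 0" "n \<ge> 2" using R C0k k by linarith+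
  have \<delta>E: "\<delta> (x - y) \<le> k" if xy: "x \<in> E" "y \<in> E" for x y
  proof -
    obtain b c where bc: "b \<in> B" "c \<in> B" "x mod p = b mod p" "y mod p = c mod p" using E(3) xy by metis
    have "(x - y) mod p = (b - c) mod p" using bc by (metis mod_diff_cong)
    then show ?thesis using k(2)[OF bc(1,2)] \<delta>_cong by metis
  qed
  \<comment> \<open>A bound for the proportion of \<open>B\<close> that may be missing from
    \<open>E\<close>.\<close>
  define s where "s = C0 * real k / real n"
  have s: "s \<le> 1 / 6" "s \<ge> 0" "s * real n = C0 * real k" unfolding s_def using R n0 C0 C0k by (auto simp: field_simps)
  have cE2: "real (card E) \<ge> real k + 2 - s * (real k + 2)" using cE unfolding s_def[symmetric] by (simp add: algebra_simps)
  have "s * (real k + 2) \<le> s * (3 * real k)" using k s by (intro mult_left_mono) auto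
  then have cE3: "real (card E) \<ge> real k + 2 - 3 * s * real k" using cE2 by simp
  have sk: "3 * s * real k \<le> real k / 2" using mult_right_mono[OF s(1), of "real k"] by simp
  then have "real (k + 2) \<le> real (2 * card E)" using cE3 by simp
  then have big: "k + 2 \<le> 2 * card E" by (simp only: of_nat_le_iff)
  define L where "L = Max E - Min E"
  have "real (3492 * k) \<le> real n" using R C0k by simp
  then have kn: "3492 * k \<le> n" by (simp only: of_nat_le_iff)
  have struct: "L * int (\<delta> x) \<le> int k * (\<bar>x\<bar> + 582 * L)" for x
    unfolding L_def by (rule \<delta>_le_of_short_generators[OF E(1,2) k(1) \<delta>E big E(4) gcdE kn p(2)])
  have "E \<subseteq> {Min E..Max E}" using E by auto
  then have "card E \<le> card {Min E..Max E}" by (intro card_mono) auto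
  then have "real_of_int L + 1 \<ge> real (card E)"
  proof -
    have "Min E \<le> Max E" using E Min_le[of E 0] Max_ge[of E 0] by linarith
    then show ?thesis using \<open>card E \<le> card {Min E..Max E}\<close> unfolding L_def by simp
  qed
  then have Lk: "real_of_int L \<ge> real k * (1 - 3 * s)" and Lhalf: "real_of_int L \<ge> real k / 2"
    using cE3 sk by (auto simp: algebra_simps)
  then have L0: "real_of_int L > 0" using k by linarith
  define \<kappa> where "\<kappa> = real k / real_of_int L"
  have \<kappa>0: "\<kappa> \<ge> 0" "\<kappa> \<le> 2" unfolding \<kappa>_def using L0 Lhalf by (auto simp: pos_divide_le_eq)
  have tent: "real (\<delta> x) \<le> \<kappa> * real_of_int \<bar>x\<bar> + 582 * real k" for x
  proof -
    have "real_of_int (L * int (\<delta> x)) \<le> real_of_int (int k * (\<bar>x\<bar> + 582 * L))" using struct by (simp only: of_int_le_iff)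
    then have "real_of_int L * real (\<delta> x) \<le> real k * real_of_int \<bar>x\<bar> + 582 * real k * real_of_int L" by (simp add: algebra_simps)
    then have "real (\<delta> x) \<le> (real k * real_of_int \<bar>x\<bar> + 582 * real k * real_of_int L) / real_of_int L"
      using L0 by (simp add: pos_le_divide_eq mult.commute)
    then show ?thesis unfolding \<kappa>_def using L0 by (simp add: add_divide_distrib)
  qed
  \<comment> \<open>\<open>L\<close> falls short of \<open>k\<close> at most by the factor
    \<open>1 - 3 * s\<close>, so the slope exceeds \<open>1\<close> by at most \<open>6 * s\<close>,
    which is \<open>O(k / n)\<close>.\<close>
  have "\<kappa> * (1 - 3 * s) \<le> 1" unfolding \<kappa>_def using L0 Lk by (simp add: pos_divide_le_eq)
  then have "\<kappa> - 1 \<le> 3 * s * \<kappa>" by (simp add: algebra_simps)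
  also have "\<dots> \<le> 6 * s" using mult_left_mono[OF \<kappa>0(2), of "3 * s"] s by simp
  finally have "(\<kappa> - 1) * real n \<le> 6 * s * real n" by (intro mult_right_mono) auto
  then have \<kappa>n: "(\<kappa> - 1) * real n \<le> 6 * C0 * real k" using s(3) by (simp add: mult.assoc)
  \<comment> \<open>Large enough to absorb \<open>16 * 582 + 4 * 6 * C0 + 2\<close>, the outcome of
    \<open>outlier_bound\<close>.\<close>
  define C2 where "C2 = 10000 * C0"
  have close: "\<bar>real_of_int x\<bar> \<le> C2 * real k" if x: "2 * \<bar>x\<bar> \<le> p" "\<delta> x \<le> k" for x
  proof (cases "x = 0")
    case True
    then show ?thesis using C0 unfolding C2_def by simp
  next
    case False
    have "\<delta> \<bar>x\<bar> \<le> k" using x(2) \<delta>_minus[of x] by (simp add: abs_if)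
    then have "real (\<delta> \<bar>x\<bar>) \<le> 582 * real k" by linarith
    moreover have one: "1 \<le> C0 * real k" using C0k k by linarith
    then have "16 * (582 * real k) + 4 * (6 * C0 * real k) + 2 < real n"
      using R C0k by (simp add: mult.assoc)
    ultimately have "real_of_int \<bar>x\<bar> \<le> 16 * (582 * real k) + 4 * (6 * C0 * real k) + 2"
      using False x(1) C0
      by (intro outlier_bound[OF tent _ _ _ \<kappa>0(1) \<kappa>n _ n0(2) p(2)]) auto
    also have "\<dots> \<le> C2 * real k" unfolding C2_def mult.assoc using C0k one by linarith
    finally show ?thesis by simp
  qed
  define E1 where "E1 = centred ` B"
  have "inj_on centred B" by (rule inj_onI) (metis B(2) centred_mod inj_onD)
  then have cE1: "card E1 = k + 2" unfolding E1_def using B(3) by (simp add: card_image)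
  have fE1: "finite E1" unfolding E1_def using B(1) by simp
  have \<delta>E1: "\<delta> (x - y) \<le> k" if xy: "x \<in> E1" "y \<in> E1" for x y
  proof -
    obtain b c where bc: "b \<in> B" "c \<in> B" "x = centred b" "y = centred c" using xy unfolding E1_def by blast
    have "(x - y) mod p = (b - c) mod p" using bc centred_mod by (metis mod_diff_cong)
    then show ?thesis using k(2)[OF bc(1,2)] \<delta>_cong by metis
  qed
  have E1_small: "\<bar>real_of_int x\<bar> \<le> C2 * real k" if "x \<in> E1" for x
  proof -
    obtain b where b: "b \<in> B" "x = centred b" using \<open>x \<in> E1\<close> unfolding E1_def by blast
    have "\<delta> x = \<delta> b" using b centred_mod \<delta>_cong by metis
    then have "\<delta> x \<le> k" using k(2)[OF b(1) B(4)] by simp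
    then show ?thesis using close centred_abs b by blast
  qed
  have neE1: "E1 \<noteq> {}" using cE1 by auto
  have mm: "Max E1 \<in> E1" "Min E1 \<in> E1" using fE1 neE1 by auto
  define L1 where "L1 = Max E1 - Min E1"
  have L1_le: "real_of_int L1 \<le> 2 * (C2 * real k)"
    unfolding L1_def using E1_small[OF mm(1)] E1_small[OF mm(2)] by simp
  have "E1 \<subseteq> {Min E1..Max E1}" using fE1 by auto
  then have "card E1 \<le> card {Min E1..Max E1}" by (intro card_mono) auto
  then have L1_ge: "L1 \<ge> int k + 1" using cE1 unfolding L1_def by simp
  define \<kappa>1 where "\<kappa>1 = real k / real_of_int L1"
  have L10: "real_of_int L1 > 0" using L1_ge by simp
  have \<kappa>10: "\<kappa>1 \<ge> 0" unfolding \<kappa>1_def using L10 by simp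
  \<comment> \<open>Division by \<open>L1\<close>: the multiple of \<open>L1\<close> costs
    \<open>k\<close> per unit of the quotient, while the remainder is \<open>O(k)\<close> and is
    handled by the first tent.\<close>
  have tent1: "real (\<delta> x) \<le> \<kappa>1 * real_of_int \<bar>x\<bar> + (4 * C2 + 583) * real k" for x
  proof -
    define q where "q = x div L1"
    define z where "z = x mod L1"
    have x: "x = q * L1 + z" unfolding q_def z_def by simp
    have z: "0 \<le> z" "z < L1" unfolding z_def using L1_ge by auto
    have "\<delta> L1 \<le> k" using \<delta>E1[OF mm] unfolding L1_def .
    then have "\<delta> (q * L1) \<le> nat \<bar>q\<bar> * k" using \<delta>_mult[of q L1] by (meson mult_le_mono2 order_trans)
    then have "\<delta> x \<le> nat \<bar>q\<bar> * k + \<delta> z" using \<delta>_add[of "q * L1" z] x by simp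
    then have "real (\<delta> x) \<le> real (nat \<bar>q\<bar> * k + \<delta> z)" by (rule of_nat_mono)
    then have 1: "real (\<delta> x) \<le> real_of_int \<bar>q\<bar> * real k + real (\<delta> z)" by simp
    have "\<bar>q\<bar> * L1 = \<bar>q * L1\<bar>" using L1_ge by (simp add: abs_mult)
    also have "\<dots> \<le> \<bar>x\<bar> + L1" using x z by linarith
    finally have "real_of_int (\<bar>q\<bar> * L1) \<le> real_of_int (\<bar>x\<bar> + L1)" by (simp only: of_int_le_iff)
    then have "real_of_int \<bar>q\<bar> \<le> (real_of_int \<bar>x\<bar> + real_of_int L1) / real_of_int L1"
      using L10 by (simp add: pos_le_divide_eq)
    then have "real_of_int \<bar>q\<bar> * real k \<le> (real_of_int \<bar>x\<bar> + real_of_int L1) / real_of_int L1 * real k"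
      by (rule mult_right_mono) simp
    also have "\<dots> = \<kappa>1 * real_of_int \<bar>x\<bar> + real k" unfolding \<kappa>1_def using L10 by (simp add: field_simps)
    finally have 2: "real_of_int \<bar>q\<bar> * real k \<le> \<kappa>1 * real_of_int \<bar>x\<bar> + real k" .
    have "\<kappa> * real_of_int \<bar>z\<bar> \<le> 2 * (2 * (C2 * real k))"
      using \<kappa>0 z L1_le by (intro mult_mono) auto
    then have 3: "real (\<delta> z) \<le> 4 * (C2 * real k) + 582 * real k" using tent[of z] by linarith
    show ?thesis using 1 2 3 unfolding distrib_right mult.assoc by linarith
  qed
  have "real n * (1 - \<kappa>1) \<le> 1 + 2 * ((4 * C2 + 583) * real k)"
    by (rule slope_ge[OF tent1]) (use n0 p \<kappa>10 C0 in \<open>auto simp: C2_def\<close>)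
  also have "\<dots> \<le> 82000 * C0 * real k"
  proof -
    have "1 \<le> C0 * real k" using C0k k by linarith
    then show ?thesis using C0k unfolding C2_def by (simp add: algebra_simps)
  qed
  finally have sl: "real n * (1 - \<kappa>1) \<le> 82000 * C0 * real k" .
  \<comment> \<open>The product \<open>101 * 82000\<close> stays below the constant
    \<open>10000000\<close> in the hypothesis on \<open>n\<close>.\<close>
  have "\<kappa>1 \<ge> 100 / 101"
  proof (rule ccontr)
    assume "\<not> ?thesis"
    then have "1 / 101 \<le> 1 - \<kappa>1" by simp
    then have "real n * (1 / 101) \<le> real n * (1 - \<kappa>1)" by (intro mult_left_mono) auto
    then have "real n \<le> 101 * (82000 * C0 * real k)" using sl by linarith
    moreover have "C0 * real k > 0" using C0 k by simp
    ultimately show False using R by simp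
  qed
  then have "real_of_int L1 \<le> 101 / 100 * real k" unfolding \<kappa>1_def using L10 by (simp add: pos_le_divide_eq)
  then show ?thesis
    using card_le_of_short_differences[OF fE1 cE1 k(1) \<delta>E1 _ p] unfolding L1_def by blast
qed

end

section \<open>Concentration on a short arc\<close>

lemma inj_on_mult_mod:
  fixes p \<nu> :: int
  assumes "p > 0" "coprime \<nu> p"
  shows "inj_on (\<lambda>x. (\<nu> * x) mod p) {0..<p}"
proof (rule inj_onI)
  fix x y assume xy: "x \<in> {0..<p}" "y \<in> {0..<p}" "(\<nu> * x) mod p = (\<nu> * y) mod p"
  then have "p dvd \<nu> * (x - y)" by (simp add: mod_eq_dvd_iff right_diff_distrib)
  then have "p dvd x - y" using assms(2) by (simp add: coprime_commute coprime_dvd_mult_right_iff)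
  then have "x mod p = y mod p" by (simp add: mod_eq_dvd_iff)
  then show "x = y" using xy by simp
qed

context cyclic_set
begin

lemma dilate:
  assumes "coprime \<nu> p" and A'_def: "A' = (\<lambda>a. (\<nu> * a) mod p) ` A"
  shows "cyclic_set p A'" "cyclic_set.n A' = n" "cyclic_set.\<delta> p A' (\<nu> * x) = \<delta> x"
proof -
  let ?f = "\<lambda>a. (\<nu> * a) mod p"
  have inj: "inj_on ?f {0..<p}" by (rule inj_on_mult_mod[OF p_pos assms(1)])
  show C: "cyclic_set p A'"
    by unfold_locales (use prime_p p_pos in \<open>auto simp: A'_def\<close>)
  interpret A': cyclic_set p A' by (rule C)
  have injA: "inj_on ?f A" by (rule inj_on_subset[OF inj A])
  show "A'.n = n" unfolding A'.n_def n_def by (subst A'_def) (rule card_image[OF injA])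
  have step: "(?f a + \<nu> * x) mod p = ?f ((a + x) mod p)" for a
    by (simp add: mod_simps distrib_left)
  have mem: "(?f a + \<nu> * x) mod p \<in> A' \<longleftrightarrow> (a + x) mod p \<in> A" for a
    unfolding step A'_def using inj_on_image_mem_iff[OF inj _ A] p_pos by simp
  have "{a' \<in> A'. Q a'} = ?f ` {a \<in> A. Q (?f a)}" for Q unfolding A'_def by auto
  from this[of "\<lambda>a'. (a' + \<nu> * x) mod p \<notin> A'"]
  have "{a' \<in> A'. (a' + \<nu> * x) mod p \<notin> A'} = ?f ` {a \<in> A. (a + x) mod p \<notin> A}"
    unfolding mem .
  then show "A'.\<delta> (\<nu> * x) = \<delta> x"
    unfolding A'.\<delta>_def \<delta>_def using card_image[OF inj_on_subset[OF injA]] by simp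
qed

text \<open>A concentrating frequency \<open>r\<close> brings most of \<open>B\<close>, translated
  by \<open>c\<close> and multiplied by \<open>r\<close>, into the arc of radius
  \<open>p / 2400\<close>. Dividing by the greatest common divisor of the images is one more
  dilation; it achieves the gcd condition and keeps the arc short.\<close>

lemma card_le_of_small_differences:
  defines "C0 \<equiv> 2 / (1 - cos (2 * pi / 2400))"
  assumes B: "finite B" "inj_on (\<lambda>x. x mod p) B" "card B = k + 2"
    and k: "k \<ge> 1" "\<And>b c. b \<in> B \<Longrightarrow> c \<in> B \<Longrightarrow> \<delta> (b - c) \<le> k"
    and p: "8 * (int k + 2)\<^sup>2 < p" "2 * int n < p"
    and R: "real n \<ge> 10000000 * C0 * real k"
  shows "real n \<le> 50 * real k * (1 + ln (real k))"
proof -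
  define e0 where "e0 = 1 - cos (2 * pi / 2400)"
  have "cos (2 * pi / 2400) < cos 0" by (rule cos_monotone_0_pi) auto
  then have e0: "e0 > 0" "e0 \<le> 2" unfolding e0_def using cos_ge_minus_one[of "2 * pi / 2400"] by auto
  have C0: "C0 \<ge> 1" "C0 = 2 / e0" unfolding C0_def e0_def[symmetric] using e0 by (auto simp: pos_le_divide_eq)
  have C0k: "real k \<le> C0 * real k" using C0 mult_right_mono[of 1 C0 "real k"] by simp
  have n0: "n > 0" using R C0k k by linarith
  have neB: "B \<noteq> {}" using B by auto
  obtain r c where r: "r \<in> {1..<p}" and c: "c \<in> B"
    and sm: "(\<Sum>b\<in>B. 1 - cos (2 * pi * r * (b - c) / p)) \<le> 2 * real k / real n * real (card B)"
    using ex_concentrating_frequency[OF B(1) neB k p(2) n0] by blast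
  define f where "f b = centred (r * (b - c))" for b
  have cosf: "cos (2 * pi * r * (b - c) / p) = cos (2 * pi * f b / p)" for b
  proof -
    obtain q where q: "r * (b - c) = f b + p * q"
      using centred_mod[of "r * (b - c)"] unfolding f_def by (metis mod_eq_dvd_iff dvd_def diff_eq_eq add.commute)
    have "2 * pi * r * (b - c) / p = 2 * pi * real_of_int (r * (b - c)) / p" by simp
    also have "\<dots> = 2 * pi * f b / p + 2 * pi * q" unfolding q using p_pos by (simp add: field_simps)
    finally have "cos (2 * pi * r * (b - c) / p) = cos (2 * pi * f b / p + 2 * pi * q)" by simp
    also have "\<dots> = cos (2 * pi * f b / p)"
      using cos_int_2pin[of q] sin_int_2pin[of q] by (simp add: cos_add)
    finally show ?thesis .
  qed
  define G where "G = {b \<in> B. 2400 * \<bar>f b\<bar> \<le> p}"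
  \<comment> \<open>Each element outside the arc costs at least \<open>e0\<close>, so their
    proportion in \<open>B\<close> is at most \<open>C0 * k / n\<close> with
    \<open>C0 = 2 / e0\<close>.\<close>
  have far: "e0 \<le> 1 - cos (2 * pi * f b / p)" if "b \<in> B - G" for b
  proof -
    have "p < 2400 * \<bar>f b\<bar>" using that unfolding G_def by auto
    then have lo: "2 * pi / 2400 \<le> 2 * pi * real_of_int \<bar>f b\<bar> / p" using p_pos by (simp add: field_simps flip: of_int_less_iff)
    have "2 * \<bar>f b\<bar> \<le> p" unfolding f_def by (rule centred_abs)
    then have "2 * real_of_int \<bar>f b\<bar> \<le> p" by linarith
    then have "2 * pi * real_of_int \<bar>f b\<bar> / p \<le> pi" using p_pos by (simp add: pos_divide_le_eq)
    then have "cos (2 * pi * real_of_int \<bar>f b\<bar> / p) \<le> cos (2 * pi / 2400)"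
      using lo by (intro cos_monotone_0_pi_le) auto
    moreover have "cos (2 * pi * real_of_int \<bar>f b\<bar> / p) = cos (2 * pi * f b / p)" by (simp add: abs_if)
    ultimately show ?thesis unfolding e0_def by simp
  qed
  have "real (card (B - G)) * e0 \<le> (\<Sum>b\<in>B - G. 1 - cos (2 * pi * f b / p))"
    using far by (intro sum_bounded_below) auto
  also have "\<dots> \<le> (\<Sum>b\<in>B. 1 - cos (2 * pi * f b / p))"
    using B(1) by (intro sum_mono2) auto
  also have "\<dots> \<le> 2 * real k / real n * real (card B)" using sm unfolding cosf .
  finally have "real (card (B - G)) \<le> 2 * real k / real n * real (card B) / e0"
    using e0 by (simp only: pos_le_divide_eq)
  also have "\<dots> = C0 * real k / real n * (real k + 2)"
    unfolding C0(2) using B(3) by (simp add: algebra_simps)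
  finally have "real (card (B - G)) \<le> C0 * real k / real n * (real k + 2)" .
  moreover have GB: "G \<subseteq> B" unfolding G_def by auto
  then have "card (B - G) = card B - card G" using B(1) by (intro card_Diff_subset finite_subset[OF GB]) auto
  moreover have "card G \<le> card B" using GB B(1) by (rule card_mono[rotated])
  ultimately have cG: "real (card G) \<ge> (1 - C0 * real k / real n) * (real k + 2)"
    using B(3) by (simp add: of_nat_diff algebra_simps)
  have fc: "f c = 0" unfolding f_def centred_def using p_pos by simp
  have r_cop: "coprime r p" using r prime_p by (intro coprime_commute[THEN iffD1, OF prime_imp_coprime]) (auto dest: zdvd_imp_le)
  have inj_f: "inj_on f B"
  proof (rule inj_onI)
    fix x y assume xy: "x \<in> B" "y \<in> B" "f x = f y"
    then have "(r * (x - c)) mod p = (r * (y - c)) mod p" using centred_mod unfolding f_def by metis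
    then have "p dvd r * (x - y)" by (simp add: mod_eq_dvd_iff algebra_simps)
    then have "p dvd x - y" using r_cop by (simp add: coprime_commute coprime_dvd_mult_right_iff)
    then show "x = y" using B(2) xy by (simp add: mod_eq_dvd_iff inj_on_def)
  qed
  define g where "g = Gcd (f ` G)"
  have "real (card G) > 1"
  proof -
    have "C0 * real k \<le> real n / 2" using R C0k by (simp add: mult.assoc)
    then have "C0 * real k / real n \<le> 1 / 2" using n0 by (simp add: pos_divide_le_eq)
    then have "(1 / 2) * (real k + 2) \<le> (1 - C0 * real k / real n) * (real k + 2)" by (intro mult_right_mono) auto
    from this cG have "(1 / 2) * (real k + 2) \<le> real (card G)" by (rule order_trans)
    then show ?thesis using k(1) by simp
  qed
  then have "\<not> G \<subseteq> {c}" using card_mono[of "{c}" G] by auto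
  then obtain b0 where b0: "b0 \<in> G" "b0 \<noteq> c" by blast
  then have fb0: "f b0 \<noteq> 0" using inj_onD[OF inj_f, of b0 c] fc c GB by auto
  then have "g \<noteq> 0" unfolding g_def using b0 by auto
  moreover have "g \<ge> 0" unfolding g_def by simp
  ultimately have g0: "g > 0" by simp
  have g_dvd: "g dvd f b" if "b \<in> G" for b unfolding g_def using that by simp
  \<comment> \<open>\<open>g\<close> divides a nonzero number of absolute value below
    \<open>p\<close>, so it is invertible modulo \<open>p\<close>.\<close>
  have "g \<le> \<bar>f b0\<bar>" using g_dvd[OF b0(1)] fb0 by (intro zdvd_imp_le) auto
  also have "\<dots> < p" using b0(1) fb0 unfolding G_def by auto
  finally have g_cop: "coprime g p" using g0 prime_p
    by (metis coprime_commute prime_imp_coprime zdvd_not_zless)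
  obtain g' where g': "[g * g' = 1] (mod p)" using cong_solve_coprime_int[OF g_cop] by blast
  \<comment> \<open>For \<open>b \<in> G\<close>, the product of \<open>\<nu>\<close> and
    \<open>b - c\<close> is congruent to the short integer \<open>f b div g\<close>.\<close>
  define \<nu> where "\<nu> = g' * r"
  have "coprime g' p" using g' by (metis coprime_iff_invertible_int mult.commute)
  then have \<nu>_cop: "coprime \<nu> p" unfolding \<nu>_def using r_cop by simp
  define A' where "A' = (\<lambda>a. (\<nu> * a) mod p) ` A"
  interpret A': cyclic_set p A' by (rule dilate(1)[OF \<nu>_cop A'_def])
  have A'n: "A'.n = n" by (rule dilate(2)[OF \<nu>_cop A'_def])
  have A'\<delta>: "A'.\<delta> (\<nu> * x) = \<delta> x" for x by (rule dilate(3)[OF \<nu>_cop A'_def])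
  define B' where "B' = (\<lambda>b. \<nu> * (b - c)) ` B"
  define E where "E = (\<lambda>b. f b div g) ` G"
  have E_mult: "f b = g * (f b div g)" if "b \<in> G" for b using g_dvd[OF that] by simp
  have "real A'.n \<le> 50 * real k * (1 + ln (real k))"
  proof (rule A'.card_le_of_mostly_short[where B = B' and E = E and ?C0.0 = C0])
    show "finite B'" unfolding B'_def using B by simp
    have inj0: "(\<nu> * (x - c)) mod p = (\<nu> * (y - c)) mod p \<Longrightarrow> x \<in> B \<Longrightarrow> y \<in> B \<Longrightarrow> x = y" for x y
    proof -
      assume xy: "(\<nu> * (x - c)) mod p = (\<nu> * (y - c)) mod p" "x \<in> B" "y \<in> B"
      then have "p dvd \<nu> * (x - y)" by (simp add: mod_eq_dvd_iff algebra_simps)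
      then have "p dvd x - y" using \<nu>_cop by (simp add: coprime_commute coprime_dvd_mult_right_iff)
      then show "x = y" using B(2) xy by (simp add: mod_eq_dvd_iff inj_on_def)
    qed
    show "inj_on (\<lambda>x. x mod p) B'"
    proof (rule inj_onI)
      fix u v assume uv: "u \<in> B'" "v \<in> B'" "u mod p = v mod p"
      then obtain x y where "x \<in> B" "u = \<nu> * (x - c)" "y \<in> B" "v = \<nu> * (y - c)" unfolding B'_def by blast
      then show "u = v" using inj0[of x y] uv(3) by blast
    qed
    have "inj_on (\<lambda>b. \<nu> * (b - c)) B"
    proof (rule inj_onI)
      fix x y assume "x \<in> B" "y \<in> B" "\<nu> * (x - c) = \<nu> * (y - c)"
      then show "x = y" using inj0[of x y] by metis
    qed
    then show "card B' = k + 2" unfolding B'_def using B by (simp add: card_image)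
    show "0 \<in> B'" unfolding B'_def using c by force
    show "A'.\<delta> (b - b') \<le> k" if bb: "b \<in> B'" "b' \<in> B'" for b b'
    proof -
      obtain x y where "x \<in> B" "y \<in> B" "b = \<nu> * (x - c)" "b' = \<nu> * (y - c)" using bb unfolding B'_def by blast
      moreover from this have "b - b' = \<nu> * (x - y)" by (simp add: algebra_simps)
      ultimately show ?thesis using A'\<delta> k(2) by simp
    qed
    show "finite E" unfolding E_def using finite_subset[OF GB B(1)] by simp
    have "c \<in> G" unfolding G_def using c fc p_pos by simp
    then show "0 \<in> E" unfolding E_def using fc by force
    show "\<exists>b\<in>B'. x mod p = b mod p" if "x \<in> E" for x
    proof -
      obtain b where b: "b \<in> G" "x = f b div g" using \<open>x \<in> E\<close> unfolding E_def by blast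
      have "g * x = f b" unfolding b(2) by (rule E_mult[OF b(1), symmetric])
      then have "[g * x = r * (b - c)] (mod p)" unfolding cong_def f_def by (simp only: centred_mod)
      then have "[g' * (g * x) = g' * (r * (b - c))] (mod p)" by (rule cong_mult[OF cong_refl])
      moreover have "[g' * (g * x) = x] (mod p)" using cong_mult[OF g' cong_refl[of x]] by (simp add: mult_ac)
      ultimately have "[x = \<nu> * (b - c)] (mod p)" unfolding \<nu>_def by (metis cong_sym cong_trans mult.assoc)
      then show ?thesis unfolding B'_def cong_def using b GB by blast
    qed
    show "2400 * \<bar>x\<bar> \<le> p" if "x \<in> E" for x
    proof -
      obtain b where b: "b \<in> G" "x = f b div g" using \<open>x \<in> E\<close> unfolding E_def by blast
      have "g * x = f b" unfolding b(2) by (rule E_mult[OF b(1), symmetric])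
      then have "\<bar>f b\<bar> = g * \<bar>x\<bar>" using g0 by (metis abs_mult abs_of_pos)
      moreover have "1 * \<bar>x\<bar> \<le> g * \<bar>x\<bar>" using g0 by (intro mult_right_mono) auto
      ultimately show ?thesis using b unfolding G_def by auto
    qed
    show "d dvd 1" if d: "\<And>x. x \<in> E \<Longrightarrow> d dvd x" for d
    proof -
      have "g * d dvd g"
      proof -
        have "g * d dvd Gcd (f ` G)"
        proof (rule Gcd_greatest)
          fix y assume "y \<in> f ` G"
          then obtain b where b: "b \<in> G" "y = f b" by blast
          then have "d dvd f b div g" using d unfolding E_def by blast
          then show "g * d dvd y" using E_mult[OF b(1)] b(2) by (metis mult_dvd_mono dvd_refl)
        qed
        then show ?thesis unfolding g_def[symmetric] .
      qed
      then show ?thesis using g0 by (metis dvd_mult_cancel_left mult.right_neutral less_irrefl)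
    qed
    have "inj_on (\<lambda>b. f b div g) G"
    proof (rule inj_onI)
      fix x y assume xy: "x \<in> G" "y \<in> G" "f x div g = f y div g"
      then have "f x = f y" using E_mult by metis
      then show "x = y" using inj_onD[OF inj_f] xy GB by blast
    qed
    then have "card E = card G" unfolding E_def by (rule card_image)
    then show "real (card E) \<ge> (1 - C0 * real k / real A'.n) * (real k + 2)" using cG A'n by simp
  qed (use k p R C0 A'n in auto)
  then show ?thesis using A'n by simp
qed

end

section \<open>Restricted sumsets\<close>

lemma card_le_card_Diff_singleton:
  assumes "finite A"
  shows "card A \<le> card (A - {x}) + 1"
  using card.remove[OF assms, of x] by (cases "x \<in> A") simp_all

text \<open>If \<open>a\<close> exits under \<open>b - c\<close>, then \<open>a + b\<close> is
  outside \<open>A + c\<close>. All these sums, except possibly for \<open>a = \<tau> b\<close>,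
  thus lie in \<open>S\<close> but outside the at least \<open>n - 1\<close> elements of
  \<open>S\<close> contributed by \<open>A + c\<close>.\<close>

lemma (in cyclic_set) \<delta>_diff_le_of_small_restricted_sumset:
  assumes S: "finite S" "S \<subseteq> {0..<p}" "\<And>a b. a \<in> A \<Longrightarrow> b \<in> B \<Longrightarrow> a \<noteq> \<tau> b \<Longrightarrow> (a + b) mod p \<in> S"
    and card: "card S + 4 \<le> n + m" and bc: "b \<in> B" "c \<in> B"
  shows "\<delta> (b - c) + 2 \<le> m"
proof -
  let ?f = "\<lambda>x a. (a + x) mod p"
  let ?X = "{a \<in> A. (a + (b - c)) mod p \<notin> A}"
  let ?T = "?f c ` (A - {\<tau> c})"
  have injA: "inj_on (?f x) A" for x by (rule inj_on_subset[OF inj_shift A])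
  have "card ?T = card (A - {\<tau> c})" by (intro card_image inj_on_subset[OF injA]) auto
  then have cT: "card ?T + 1 \<ge> n" unfolding n_def using card_le_card_Diff_singleton[OF finA, of "\<tau> c"] by simp
  have TS: "?T \<subseteq> S" using S(3) bc by auto
  have "?f b ` (?X - {\<tau> b}) \<subseteq> S - ?T"
  proof (rule image_subsetI)
    fix a assume a: "a \<in> ?X - {\<tau> b}"
    have "(a + b) mod p \<notin> ?T"
    proof
      assume "(a + b) mod p \<in> ?T"
      then obtain a' where a': "a' \<in> A" "(a + b) mod p = (a' + c) mod p" by auto
      then have "(a + (b - c)) mod p = a' mod p" by (simp add: mod_eq_dvd_iff algebra_simps)
      then show False using a a' mod_A by simp
    qed
    then show "(a + b) mod p \<in> S - ?T" using S(3) bc a by auto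
  qed
  then have "card (?f b ` (?X - {\<tau> b})) \<le> card (S - ?T)" using S(1) by (intro card_mono) auto
  moreover have "card (?f b ` (?X - {\<tau> b})) = card (?X - {\<tau> b})"
    by (intro card_image inj_on_subset[OF injA]) auto
  moreover have "\<delta> (b - c) \<le> card (?X - {\<tau> b}) + 1"
    unfolding \<delta>_def using finA by (intro card_le_card_Diff_singleton) simp
  moreover have "card (S - ?T) = card S - card ?T" using TS finA by (intro card_Diff_subset) auto
  moreover have "card ?T \<le> card S" using TS S(1) by (intro card_mono)
  ultimately show ?thesis using cT card by linarith
qed

lemma (in cyclic_set) card_restricted_sumset_ge:
  fixes c :: real
  defines "C0 \<equiv> 2 / (1 - cos (2 * pi / 2400))"
  assumes c: "c > 0" "c * (10000000 * C0) \<le> 1" "c * 200 \<le> 1"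
    and B: "B \<subseteq> {0..<p}" "B \<noteq> {}" and n: "n > 1" "2 * int n < p"
    and Bp: "8 * (int (card B))\<^sup>2 < p" and Bn: "real (card B) < c * real n / ln (real n)"
    and S: "finite S" "S \<subseteq> {0..<p}" "\<And>a b. a \<in> A \<Longrightarrow> b \<in> B \<Longrightarrow> a \<noteq> \<tau> b \<Longrightarrow> (a + b) mod p \<in> S"
  shows "int n + int (card B) - 3 \<le> int (card S)"
proof (rule ccontr)
  assume "\<not> ?thesis"
  then have small: "card S + 4 \<le> n + card B" by linarith
  have finB: "finite B" using B finite_subset by blast
  obtain b where b: "b \<in> B" using B by blast
  \<comment> \<open>A single translate already gives \<open>n - 1\<close> sums, which settles
    \<open>card B \<le> 2\<close>; afterwards \<open>k\<close> is positive.\<close>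
  have "n - 1 \<le> card S"
  proof -
    let ?T = "(\<lambda>a. (a + b) mod p) ` (A - {\<tau> b})"
    have "card ?T = card (A - {\<tau> b})"
      by (intro card_image inj_on_subset[OF inj_shift]) (use A in auto)
    then have "n - 1 \<le> card ?T" unfolding n_def using card_le_card_Diff_singleton[OF finA, of "\<tau> b"] by simp
    also have "\<dots> \<le> card S" using S b by (intro card_mono) auto
    finally show ?thesis .
  qed
  then have "3 \<le> card B" using small n by linarith
  define k where "k = card B - 2"
  have k: "card B = k + 2" "k \<ge> 1" unfolding k_def using \<open>3 \<le> card B\<close> by auto
  have \<delta>B: "\<delta> (b - c) \<le> k" if "b \<in> B" "c \<in> B" for b c
    using \<delta>_diff_le_of_small_restricted_sumset[OF S small that] k by simp
  have ln0: "ln (real n) > 0" using n by simp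
  have kn: "(real k + 2) * ln (real n) < c * real n"
    using Bn k ln0 by (simp add: pos_less_divide_eq add.commute)
  have n3: "n \<ge> 3"
  proof (rule ccontr)
    assume "\<not> n \<ge> 3"
    then have "n = 2" using n by simp
    moreover have "ln (2::real) \<ge> 1 / 2" using ln_le_minus_one[of "1 / 2"] by (simp add: ln_div)
    then have "3 * (1 / 2) \<le> (real k + 2) * ln (2::real)" using k by (intro mult_mono) auto
    ultimately show False using kn c by simp
  qed
  \<comment> \<open>This lets \<open>ln n\<close> absorb the summand \<open>1\<close> in
    \<open>1 + ln k\<close>, and yields \<open>k \<le> c * n\<close>.\<close>
  have ln1: "ln (real n) \<ge> 1"
  proof -
    have "exp 1 \<le> (3::real)" using exp_le by simp
    then have "ln (exp 1) \<le> ln (real n)" using n3 by (intro ln_mono) auto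
    then show ?thesis by simp
  qed
  have "real k * 1 \<le> (real k + 2) * ln (real n)" using ln1 by (intro mult_mono) auto
  then have kcn: "real k \<le> c * real n" using kn by linarith
  have C0: "C0 \<ge> 0" unfolding C0_def by simp
  have "10000000 * C0 * real k \<le> 10000000 * C0 * (c * real n)" using kcn C0 by (intro mult_left_mono) auto
  also have "\<dots> = (c * (10000000 * C0)) * real n" by simp
  also have "\<dots> \<le> 1 * real n" using c by (intro mult_right_mono) auto
  finally have R: "10000000 * C0 * real k \<le> real n" by simp
  have "inj_on (\<lambda>x. x mod p) B" by (rule inj_on_subset[OF inj_mod_residues B(1)])
  then have "real n \<le> 50 * real k * (1 + ln (real k))"
    using card_le_of_small_differences[OF finB _ k \<delta>B _ n(2) R[unfolded C0_def]] Bp k(1)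
    by (simp add: add.commute)
  also have "\<dots> \<le> 50 * real k * (ln (real n) + ln (real n))"
  proof (intro mult_left_mono add_mono ln1)
    have "c \<le> 1" using c(3) by simp
    then have "real k \<le> real n" using kcn mult_right_mono[of c 1 "real n"] by simp
    then show "ln (real k) \<le> ln (real n)" using k by (intro ln_mono) auto
  qed auto
  also have "\<dots> = 100 * (real k * ln (real n))" by simp
  also have "real k * ln (real n) < c * real n" using kn ln0 by (simp add: distrib_right)
  also have "100 * (c * real n) \<le> real n" using mult_right_mono[OF c(3), of "real n"] by simp
  finally show False by simp
qed

theorem theorem6:
  "\<exists>c::real. c > 0 \<and>
    (\<forall>(p::nat) (A::int set) (B::int set).
      prime p \<longrightarrow>
      A \<subseteq> carrier (residue_ring (int p)) \<longrightarrow>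
      B \<subseteq> carrier (residue_ring (int p)) \<longrightarrow>
      1 < card A \<longrightarrow> real (card A) < real p / 2 \<longrightarrow>
      0 < card B \<longrightarrow>
      real (card B) < min (sqrt (real p / 8)) (c * real (card A) / ln (real (card A))) \<longrightarrow>
      (\<forall>\<tau> \<in> B \<rightarrow> A.
        int (card (restricted_sumset (residue_ring (int p)) \<tau> A B))
          \<ge> int (card A) + int (card B) - 3))"
proof -
  define C0 where "C0 = 2 / (1 - cos (2 * pi / 2400))"
  \<comment> \<open>The first summand of the denominator makes \<open>n\<close> at least
    \<open>10000000 * C0 * k\<close>; the second makes
    \<open>100 * k * ln n < 100 * c * n \<le> n / 2\<close>, the final contradiction.\<close>
  define c where "c = 1 / (10000000 * C0 + 200)"
  have "cos (2 * pi / 2400) < cos 0" by (rule cos_monotone_0_pi) auto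
  then have C0: "C0 > 0" unfolding C0_def by simp
  then have c: "c > 0" "c * (10000000 * C0) \<le> 1" "c * 200 \<le> 1" unfolding c_def by auto
  show ?thesis
  proof (intro exI[of _ c] conjI c(1) allI impI ballI)
    fix p :: nat and A B :: "int set" and \<tau> :: "int \<Rightarrow> int"
    assume p: "prime p" and AB: "A \<subseteq> carrier (residue_ring (int p))" "B \<subseteq> carrier (residue_ring (int p))"
      and cA: "1 < card A" "real (card A) < real p / 2" and B: "0 < card B"
      "real (card B) < min (sqrt (real p / 8)) (c * real (card A) / ln (real (card A)))"
    have carr: "carrier (residue_ring (int p)) = {0..<int p}" by (auto simp: residue_ring_def)
    interpret cyclic_set "int p" A
      by unfold_locales (use p AB carr in auto)
    define S where "S = restricted_sumset (residue_ring (int p)) \<tau> A B"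
    have S: "S = {(a + b) mod int p | a b. a \<in> A \<and> b \<in> B \<and> a \<noteq> \<tau> b}"
      unfolding S_def restricted_sumset_def by (simp add: residue_ring_def)
    have "S \<subseteq> {0..<int p}" unfolding S using p_pos by auto
    have "real (card B) ^ 2 < sqrt (real p / 8) ^ 2" using B by (intro power_strict_mono) auto
    then have "real (8 * card B ^ 2) < real p" by simp
    then have "8 * card B ^ 2 < p" by (simp only: of_nat_less_iff)
    then have "int (8 * card B ^ 2) < int p" by (simp only: of_nat_less_iff)
    then have B8: "8 * (int (card B))\<^sup>2 < int p" by simp
    have "int n + int (card B) - 3 \<le> int (card S)"
    proof (rule card_restricted_sumset_ge[OF c[unfolded C0_def], where B = B and \<tau> = \<tau>])
      show "2 * int n < int p" using cA unfolding n_def by linarith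
      show "finite S" using \<open>S \<subseteq> {0..<int p}\<close> finite_subset by blast
    qed (use cA B B8 AB carr \<open>S \<subseteq> {0..<int p}\<close> in \<open>auto simp: S n_def\<close>)
    then show "int (card S) \<ge> int (card A) + int (card B) - 3" unfolding n_def .
  qed
qed

end
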